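(* Consider the problem of maximizing the communication mutual information over the transmit signal, $$\max_{\mathbf X}\ I(\mathbf X;\mathbf Y_{\rm com}|\mathbf H)\quad\text{s.t. }\mathrm{tr}(\mathbf X\mathbf X^H)\le E .$$ Define $\mathbf S=\mathbf U_{\mathbf H}^H\Sigma_{\mathbf X}\mathbf U_{\mathbf H}=[s_{ij}]$. Then this problem can be transformed into $$\max_{\mathbf S}\ F_c(\mathbf S)=N_x\sum_{i=1}^{N_tN_c}\log_2\left(\frac{\mu_{ii}s_{ii}}{\sigma_n^2}+1\right)\quad\text{s.t. }\mathrm{tr}(\mathbf S)\le E,\ s_{ii}\ge0,\ 1\le i\le N_cN_t .$$ The optimal allocation scheme is $$s_{ii}=\begin{cases}\left(-\dfrac1{\beta\ln2}-\dfrac{\sigma_n^2}{\mu_{ii}}\right)^+,&\mu_{ii}\ne0,\\[1ex]0,&\mu_{ii}=0,\end{cases}\qquad i=1,\dots,N_cN_t,$$ $$\sum_{i=1}^{N_tN_c}s_{ii}-E=0,$$ where $[x]^+=\max\{x,0\}$ and $\beta$ is the Lagrange multiplier in $L(\mathbf S)=\sum_{i=1}^{N_tN_c}\log_2(\mu_{ii}s_{ii}/\sigma_n^2+1)+\beta\left(\sum_{i=1}^{N_tN_c}s_{ii}-E\right)$.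
   Context: A MIMO-OFDM system has $N_c$ subcarriers, $N_t$ transmit and $N_r$ receive antenna elements and $N_x$ OFDM symbols. The transmit data matrix is block diagonal, $\mathbf X=\mathrm{diag}\{\mathbf X(0),\dots,\mathbf X(N_c-1)\}\in\mathbb C^{N_cN_x\times N_cN_t}$ with $\mathbf X(p)\in\mathbb C^{N_x\times N_t}$, and $\Sigma_{\mathbf X}=\mathbb E\{\mathbf X^H\mathbf X\}/N_x$. The received signal on subcarrier $p$ is $\mathbf Y_{\rm com}(p)=\mathbf X(p)\mathbf H(p)+\mathbf W_{\rm com}(p)$, with perfectly known channel $\mathbf H(p)\in\mathbb C^{N_t\times N_r}$ and noise entries i.i.d. $\mathcal{CN}(0,\sigma_n^2)$; $\mathbf Y_{\rm com}$ collects all $\mathbf Y_{\rm com}(p)$ and $\mathbf H=\mathrm{diag}\{\mathbf H(0),\dots,\mathbf H(N_c-1)\}\in\mathbb C^{N_tN_c\times N_rN_c}$. The communication mutual information (in bits) is $$I(\mathbf X;\mathbf Y_{\rm com}|\mathbf H)=N_x\log_2\left[(\sigma_n^2)^{-N_rN_c}\det(\mathbf H^H\Sigma_{\mathbf X}\mathbf H+\sigma_n^2\mathbf I_{N_rN_c})\right].$$ $\mathbf H\mathbf H^H=\mathbf U_{\mathbf H}\mathbf\Lambda_{\mathbf H}\mathbf U_{\mathbf H}^H$ with $\mathbf U_{\mathbf H}$ unitary and $\mathbf\Lambda_{\mathbf H}$ diagonal with diagonal entries $\mu_{ii}$, $1\le i\le N_tN_c$. $E$ is the average transmit power constraint; $\mathbb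 E$ is expectation; $(\cdot)^H$ is conjugate transpose; $\mathrm{diag}\{\cdot\}$ of matrices is block diagonal.
   Formalization: The power constraint is read as E{tr(XX^H)}/N_x ≤ E, since with tr(XX^H) ≤ E the transformed budget would be E/N_x when N_x>1; the allocation formula with sum s_ii = E is claimed only if some μ_ii ≠ 0, as for H = 0 it is contradictory. *)

theory Defs
  imports "HOL-Probability.Probability"
begin

definition ctranspose :: "complex^'n^'m \<Rightarrow> complex^'m^'n"  ("_\<^sup>H" [1000] 999)
  where "A\<^sup>H = (\<chi> i j. cnj (A $ j $ i))"

definition unitary_matrix :: "complex^'n^'n \<Rightarrow> bool"
  where "unitary_matrix U \<longleftrightarrow> U\<^sup>H ** U = mat 1 \<and> U ** U\<^sup>H = mat 1"

definition diag_matrix :: "('n::finite \<Rightarrow> real) \<Rightarrow> complex^'n^'n"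
  where "diag_matrix d = (\<chi> i j. if i = j then complex_of_real (d i) else 0)"

(* Rows and columns of diag{B(0), ..., B(N_c - 1)} are indexed by pairs
   (subcarrier, index inside the block). *)
definition block_diag :: "('c::finite \<Rightarrow> complex^'n::finite^'m::finite) \<Rightarrow> complex^('c \<times> 'n)^('c \<times> 'm)"
  where "block_diag B =
    (\<chi> i j. if fst i = fst j then B (fst i) $ snd i $ snd j else 0)"

(* Index types: 'c subcarriers (N_c), 't transmit antennas (N_t), 'r receive antennas (N_r),
   'x OFDM symbols (N_x).  The random transmit signal is represented by its law P, a
   probability distribution on the families of blocks X(p), p in 'c; expectations over the
   signal are integrals with respect to P. *)

type_synonym ('c, 't, 'x) blocks = "((complex^'t)^'x)^'c"

definition data_matrix ::
    "('c::finite, 't::finite, 'x::finite) blocks \<Rightarrow> complex^('c \<times> 't)^('c \<times> 'x)"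
  where "data_matrix B = block_diag (\<lambda>p. B $ p)"

(* The integrability condition says that the average power is finite; without it the
   Bochner integral below would silently be 0. *)
definition tx_signal :: "('c::finite, 't::finite, 'x::finite) blocks measure \<Rightarrow> bool"
  where "tx_signal P \<longleftrightarrow> prob_space P \<and> sets P = sets borel \<and>
    integrable P (\<lambda>B. (data_matrix B)\<^sup>H ** data_matrix B)"

definition Sigma_X ::
    "('c::finite, 't::finite, 'x::finite) blocks measure \<Rightarrow> complex^('c \<times> 't)^('c \<times> 't)"
  where "Sigma_X P =
    (1 / real CARD('x)) *\<^sub>R (\<integral>B. (data_matrix B)\<^sup>H ** data_matrix B \<partial>P)"

(* Expectation of tr(X X^H), per OFDM symbol: the normalisation 1/N_x is the one of Sigma_X,
   so that the transmit power is tr(Sigma_X). *)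
definition avg_power :: "('c::finite, 't::finite, 'x::finite) blocks measure \<Rightarrow> real"
  where "avg_power P =
    (\<integral>B. Re (trace (data_matrix B ** (data_matrix B)\<^sup>H)) \<partial>P) / real CARD('x)"

definition tx_feasible ::
    "real \<Rightarrow> ('c::finite, 't::finite, 'x::finite) blocks measure \<Rightarrow> bool"
  where "tx_feasible E P \<longleftrightarrow> tx_signal P \<and> avg_power P \<le> E"

(* The determinant of the Hermitian matrix is real; Re only changes its type. *)
definition comm_MI ::
    "real \<Rightarrow> ('c \<Rightarrow> complex^'r^'t) \<Rightarrow>
     ('c::finite, 't::finite, 'x::finite) blocks measure \<Rightarrow> real"
  where "comm_MI \<sigma> H P = real CARD('x) *
    log 2 ((\<sigma>\<^sup>2) powi (- int (CARD('r::finite) * CARD('c))) *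
      Re (det ((block_diag H)\<^sup>H ** Sigma_X P ** block_diag H
        + mat (complex_of_real (\<sigma>\<^sup>2)))))"

definition S_matrix ::
    "complex^('c::finite \<times> 't::finite)^('c \<times> 't) \<Rightarrow>
     ('c, 't, 'x::finite) blocks measure \<Rightarrow> complex^('c \<times> 't)^('c \<times> 't)"
  where "S_matrix U P = U\<^sup>H ** Sigma_X P ** U"

definition alloc_feasible :: "real \<Rightarrow> complex^'n^'n \<Rightarrow> bool"
  where "alloc_feasible E S \<longleftrightarrow> Re (trace S) \<le> E \<and>
    (\<forall>i. S $ i $ i \<in> \<real> \<and> 0 \<le> Re (S $ i $ i))"

definition F_c :: "nat \<Rightarrow> real \<Rightarrow> ('n::finite \<Rightarrow> real) \<Rightarrow> complex^'n^'n \<Rightarrow> real"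
  where "F_c Nx \<sigma> \<mu> S =
    real Nx * (\<Sum>i\<in>UNIV. log 2 (\<mu> i * Re (S $ i $ i) / \<sigma>\<^sup>2 + 1))"

(* The Lagrangian depends on S only through its diagonal s. *)
definition lagrangian ::
    "real \<Rightarrow> real \<Rightarrow> ('n \<Rightarrow> real) \<Rightarrow> ('n::finite \<Rightarrow> real) \<Rightarrow> real \<Rightarrow> real"
  where "lagrangian E \<sigma> \<mu> s \<beta> =
    (\<Sum>i\<in>UNIV. log 2 (\<mu> i * s i / \<sigma>\<^sup>2 + 1)) + \<beta> * ((\<Sum>i\<in>UNIV. s i) - E)"

(* Karush-Kuhn-Tucker conditions for maximisation subject to sum s <= E and s >= 0; the
   multipliers of the sign constraints are eliminated.  The constraint enters the Lagrangian
   with a plus sign, hence beta <= 0. *)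
definition lagrange_multiplier ::
    "real \<Rightarrow> real \<Rightarrow> ('n \<Rightarrow> real) \<Rightarrow> ('n::finite \<Rightarrow> real) \<Rightarrow> real \<Rightarrow> bool"
  where "lagrange_multiplier E \<sigma> \<mu> s \<beta> \<longleftrightarrow>
    \<beta> \<le> 0 \<and> \<beta> * ((\<Sum>i\<in>UNIV. s i) - E) = 0 \<and>
    (\<forall>i. \<exists>d. ((\<lambda>t. lagrangian E \<sigma> \<mu> (s(i := t)) \<beta>) has_real_derivative d) (at (s i)) \<and>
      d \<le> 0 \<and> (0 < s i \<longrightarrow> d = 0))"

definition alloc :: "real \<Rightarrow> ('n \<Rightarrow> real) \<Rightarrow> real \<Rightarrow> 'n \<Rightarrow> real"
  where "alloc \<sigma> \<mu> \<beta> i =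
    (if \<mu> i \<noteq> 0 then max (- 1 / (\<beta> * ln 2) - \<sigma>\<^sup>2 / \<mu> i) 0 else 0)"

end

theory Submission
  imports Defs
begin

text \<open>With \<open>D\<close> the diagonal matrix of the \<open>sqrt (\<mu> i / \<sigma>\<^sup>2)\<close>, the identity
  \<open>det (1 + A B) = det (1 + B A)\<close> turns the mutual information into the logarithm of
  \<open>det (1 + D S D)\<close>, and Hadamard's inequality bounds this determinant by the product of the
  diagonal entries, with equality for diagonal \<open>S\<close>. The resulting concave problem in the diagonal
  is solved by comparing each logarithm with its tangent at the water-filling point. The optimal
  \<open>S\<close> is attained by a signal because \<open>U diag(s) U\<^sup>H\<close> is a function of \<open>H H\<^sup>H\<close>,
  hence block diagonal as a covariance of the data matrix must be.\<close>

section \<open>Determinants of block matrices\<close>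

text \<open>The mutual information contains a matrix of receive dimension, whereas \<open>S\<close>
  has transmit dimension. The determinant identity is therefore needed for rectangular factors, and
  it is used twice: once to replace \<open>H\<close> by \<open>H H\<^sup>H\<close>, once to bring a
  factor \<open>D\<close> to either side of \<open>S\<close>. The square roots in \<open>D\<close>
  serve the second use: \<open>D S D\<close> is Hermitian and positive semidefinite, which the
  one-sided product \<open>D D S\<close> need not be, and Hadamard's inequality asks for it. The
  tangent at the water-filling point has slope at most \<open>- \<beta>\<close>, the price of power.
  Strictness of the comparison makes the optimal diagonal unique, even at indices with
  \<open>\<mu> i = 0\<close>, where only the price of wasted power decides.\<close>

lemma det_restrict_identity_rows:
  fixes A :: "'a::comm_ring_1^'k^'k" and f :: "'m::finite \<Rightarrow> 'k::finite"
  assumes "inj f"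
    and rows: "\<And>k j. k \<notin> range f \<Longrightarrow> A $ k $ j = (if j = k then 1 else 0)"
  shows "det A = det (\<chi> i j. A $ f i $ f j)"
proof -
  let ?g = "\<lambda>p. of_int (sign p) * (\<Prod>i\<in>UNIV. A $ i $ p i) :: 'a"
  have bij: "bij_betw f UNIV (range f)"
    using assms(1) by (simp add: bij_betw_def)
  have map_eq: "map_permutation UNIV f p =
      (\<lambda>x. if x \<in> range f then f (p (inv_into UNIV f x)) else x)" for p
    by (auto simp: map_permutation_def restrict_id_def fun_eq_iff)
  \<comment> \<open>A permutation that moves an index outside \<open>range f\<close> meets a zero of
    an identity row, so only the permutations of \<open>range f\<close> contribute to the Leibniz
    sum.\<close>
  have "det A = (\<Sum>p | p permutes range f. ?g p)"
    unfolding det_def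
  proof (rule sum.mono_neutral_right)
    show "finite {p. p permutes (UNIV :: 'k set)}" by simp
    show "{p. p permutes range f} \<subseteq> {p. p permutes UNIV}"
      using permutes_subset by blast
    show "\<forall>p\<in>{p. p permutes UNIV} - {p. p permutes range f}. ?g p = 0"
    proof
      fix p assume "p \<in> {p. p permutes (UNIV::'k set)} - {p. p permutes range f}"
      then obtain k where "k \<notin> range f" "p k \<noteq> k"
        unfolding permutes_def by auto
      then have "A $ k $ p k = 0" using rows by simp
      then have "(\<Prod>i\<in>UNIV. A $ i $ p i) = 0"
        by (intro prod_zero) auto
      then show "?g p = 0" by simp
    qed
  qed
  \<comment> \<open>\<open>map_permutation\<close> transports a permutation along \<open>f\<close>
    and fixes all other indices; the sign survives because \<open>f\<close> is injective.\<close>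
  also have "\<dots> = (\<Sum>p | p permutes (UNIV :: 'm set). ?g (map_permutation UNIV f p))"
    using sum.reindex_bij_betw[OF bij_betw_permutations[OF bij], of ?g] by (simp add: map_eq)
  also have "\<dots> = det (\<chi> i j. A $ f i $ f j)"
    unfolding det_def
  proof (rule sum.cong[OF refl])
    fix p :: "'m \<Rightarrow> 'm" assume "p \<in> {p. p permutes UNIV}"
    then have p: "p permutes UNIV" by simp
    let ?q = "map_permutation UNIV f p"
    have "(\<Prod>i\<in>UNIV. A $ i $ ?q i) = (\<Prod>i\<in>range f. A $ i $ ?q i)"
    proof (rule prod.mono_neutral_right)
      show "\<forall>i\<in>UNIV - range f. A $ i $ ?q i = 1"
        using rows by (auto simp: map_eq)
    qed auto
    also have "\<dots> = (\<Prod>i\<in>UNIV. A $ f i $ f (p i))"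
      using assms(1) by (simp add: prod.reindex map_permutation_apply)
    finally show "?g ?q = of_int (sign p) * (\<Prod>i\<in>UNIV. (\<chi> i j. A $ f i $ f j) $ i $ p i)"
      using assms(1) p by (simp add: sign_map_permutation)
  qed
  finally show ?thesis .
qed

definition block4 ::
    "'a::zero^'m^'m \<Rightarrow> 'a^'n^'m \<Rightarrow> 'a^'m^'n \<Rightarrow> 'a^'n^'n \<Rightarrow> 'a^('m::finite + 'n::finite)^('m + 'n)"
  where "block4 P Q R S = (\<chi> i j. case i of
      Inl a \<Rightarrow> (case j of Inl b \<Rightarrow> P $ a $ b | Inr b \<Rightarrow> Q $ a $ b)
    | Inr a \<Rightarrow> (case j of Inl b \<Rightarrow> R $ a $ b | Inr b \<Rightarrow> S $ a $ b))"

lemma block4_mult: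
  fixes P :: "'a::comm_ring_1^'m::finite^'m" and S :: "'a^'n::finite^'n"
  shows "block4 P Q R S ** block4 P' Q' R' S' =
    block4 (P ** P' + Q ** R') (P ** Q' + Q ** S') (R ** P' + S ** R') (R ** Q' + S ** S')"
  by (simp add: vec_eq_iff block4_def matrix_matrix_mult_def split: sum.splits
      flip: UNIV_Plus_UNIV add: sum.Plus)

lemma det_block4_upper:
  fixes P :: "'a::comm_ring_1^'m::finite^'m" and Q :: "'a^'n::finite^'m"
  shows "det (block4 P Q 0 (mat 1)) = det P"
proof -
  have "det (block4 P Q 0 (mat 1)) =
      det (\<chi> i j. block4 P Q 0 (mat 1) $ (Inl i :: 'm + 'n) $ Inl j)"
    by (rule det_restrict_identity_rows) (auto simp: block4_def mat_def split: sum.splits)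
  then show ?thesis by (simp add: block4_def)
qed

lemma det_block4_lower:
  fixes R :: "'a::comm_ring_1^'m::finite^'n::finite" and S :: "'a^'n^'n"
  shows "det (block4 (mat 1) 0 R S) = det S"
proof -
  have "det (block4 (mat 1) 0 R S) =
      det (\<chi> i j. block4 (mat 1) 0 R S $ (Inr i :: 'm + 'n) $ Inr j)"
    by (rule det_restrict_identity_rows) (auto simp: block4_def mat_def split: sum.splits)
  then show ?thesis by (simp add: block4_def)
qed

text \<open>Both sides are the determinant of \<open>block4 (mat 1) (- A) B (mat 1)\<close>: one
  unimodular block column operation clears its lower left corner, another its upper right corner. No
  inverse is taken, so any commutative ring will do.\<close>

lemma det_one_plus_mult_commute:
  fixes A :: "'a::comm_ring_1^'n::finite^'m::finite" and B :: "'a^'m^'n"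
  shows "det (mat 1 + A ** B) = det (mat 1 + B ** A)"
proof -
  have neg: "X ** - Y = - (X ** Y)" "- X ** Y = - (X ** Y)"
    for X :: "'a^'p::finite^'q::finite" and Y :: "'a^'r::finite^'p"
    by (simp_all add: vec_eq_iff matrix_matrix_mult_def sum_negf)
  have zero: "X ** (0 :: 'a^'r::finite^'p::finite) = 0" "(0 :: 'a^'p::finite^'q::finite) ** Y = 0"
    for X :: "'a^'p::finite^'q::finite" and Y :: "'a^'r::finite^'p"
    by (simp_all add: vec_eq_iff matrix_matrix_mult_def)
  let ?M = "block4 (mat 1) (- A) B (mat 1)"
  have "?M ** block4 (mat 1) 0 (- B) (mat 1) = block4 (mat 1 + A ** B) (- A) 0 (mat 1)"
    by (simp add: block4_mult neg zero)
  then have "det ?M * det (block4 (mat 1) 0 (- B) (mat 1)) = det (mat 1 + A ** B)"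
    by (simp add: det_block4_upper flip: det_mul)
  then have "det ?M = det (mat 1 + A ** B)"
    by (simp add: det_block4_lower)
  moreover have "?M ** block4 (mat 1) A 0 (mat 1) = block4 (mat 1) 0 B (mat 1 + B ** A)"
    by (simp add: block4_mult neg zero add.commute)
  then have "det ?M * det (block4 (mat 1) A 0 (mat 1)) = det (mat 1 + B ** A)"
    by (simp add: det_block4_lower flip: det_mul)
  then have "det ?M = det (mat 1 + B ** A)"
    by (simp add: det_block4_upper)
  ultimately show ?thesis by simp
qed

section \<open>Positive definite matrices and Hadamard's inequality\<close>

lemma ctranspose_nth [simp]: "A\<^sup>H $ i $ j = cnj (A $ j $ i)"
  by (simp add: ctranspose_def)

lemma ctranspose_ctranspose [simp]: "(A\<^sup>H)\<^sup>H = A"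
  by (simp add: vec_eq_iff)

lemma ctranspose_mult: "(A ** B)\<^sup>H = B\<^sup>H ** A\<^sup>H"
  by (simp add: vec_eq_iff matrix_matrix_mult_def mult.commute)

lemma ctranspose_add: "(A + B)\<^sup>H = A\<^sup>H + B\<^sup>H"
  by (simp add: vec_eq_iff)

lemma ctranspose_mat_1 [simp]: "(mat 1)\<^sup>H = (mat 1 :: complex^'n^'n)"
  by (simp add: vec_eq_iff mat_def)

lemma diag_matrix_nth: "diag_matrix d $ i $ j = (if i = j then complex_of_real (d i) else 0)"
  by (simp add: diag_matrix_def)

lemma ctranspose_diag_matrix [simp]: "(diag_matrix d)\<^sup>H = diag_matrix d"
  by (simp add: vec_eq_iff diag_matrix_nth)

lemma matrix_mult_diag_nth: "(A ** diag_matrix d) $ i $ j = A $ i $ j * complex_of_real (d j)"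
  by (simp add: matrix_matrix_mult_def diag_matrix_nth if_distrib[of "\<lambda>x. _ * x"] cong: if_cong)

lemma diag_matrix_mult_nth: "(diag_matrix d ** A) $ i $ j = complex_of_real (d i) * A $ i $ j"
  by (simp add: matrix_matrix_mult_def diag_matrix_nth if_distrib[of "\<lambda>x. x * _"] cong: if_cong)

lemma diag_matrix_mult_diag_matrix:
  "diag_matrix d ** diag_matrix e = diag_matrix (\<lambda>i. d i * e i)"
  by (simp add: vec_eq_iff diag_matrix_mult_nth) (simp add: diag_matrix_nth)

section \<open>Hermitian forms and definiteness\<close>

definition hermitian_form :: "complex^'n^'n \<Rightarrow> complex^'n \<Rightarrow> complex"
  where "hermitian_form A v = (\<Sum>i\<in>UNIV. \<Sum>j\<in>UNIV. cnj (v $ i) * A $ i $ j * v $ j)"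

lemma hermitian_form_alt: "hermitian_form A v = (\<Sum>i\<in>UNIV. cnj (v $ i) * (A *v v) $ i)"
  by (simp add: hermitian_form_def matrix_vector_mult_def sum_distrib_left mult.assoc)

lemma hermitian_form_congruence:
  "hermitian_form (C\<^sup>H ** A ** C) v = hermitian_form A (C *v v)"
proof -
  have "hermitian_form (C\<^sup>H ** A ** C) v = (\<Sum>i\<in>UNIV. cnj (v $ i) * (C\<^sup>H *v (A *v (C *v v))) $ i)"
    by (simp add: hermitian_form_alt matrix_vector_mul_assoc matrix_mul_assoc)
  also have "\<dots> = (\<Sum>i\<in>UNIV. \<Sum>j\<in>UNIV. cnj (v $ i) * cnj (C $ j $ i) * (A *v (C *v v)) $ j)"
    by (simp add: matrix_vector_mult_def[of "C\<^sup>H"] sum_distrib_left mult.assoc)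
  also have "\<dots> = (\<Sum>j\<in>UNIV. \<Sum>i\<in>UNIV. cnj (v $ i) * cnj (C $ j $ i) * (A *v (C *v v)) $ j)"
    by (rule sum.swap)
  also have "\<dots> = (\<Sum>j\<in>UNIV. cnj ((C *v v) $ j) * (A *v (C *v v)) $ j)"
    by (simp add: matrix_vector_mult_def[of C] sum_distrib_right mult.commute)
  finally show ?thesis by (simp add: hermitian_form_alt)
qed

lemma hermitian_form_axis: "hermitian_form A (axis i 1) = A $ i $ i"
  by (simp add: hermitian_form_def axis_def if_distrib[of cnj] if_distrib[of "\<lambda>x. x * _"]
      if_distrib[of "\<lambda>x. _ * x"] cong: if_cong)

lemma hermitian_form_add: "hermitian_form (A + B) v = hermitian_form A v + hermitian_form B v"
  by (simp add: hermitian_form_def algebra_simps sum.distrib)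

lemma hermitian_form_mat_1:
  "hermitian_form (mat 1) v = complex_of_real (\<Sum>i\<in>UNIV. (cmod (v $ i))\<^sup>2)"
  unfolding hermitian_form_alt of_real_sum complex_norm_square by (simp add: mult.commute)

definition pos_semidef :: "complex^'n^'n \<Rightarrow> bool"
  where "pos_semidef A \<longleftrightarrow> A\<^sup>H = A \<and> (\<forall>v. 0 \<le> Re (hermitian_form A v))"

definition pos_def :: "complex^'n^'n \<Rightarrow> bool"
  where "pos_def A \<longleftrightarrow> A\<^sup>H = A \<and> (\<forall>v. v \<noteq> 0 \<longrightarrow> 0 < Re (hermitian_form A v))"

lemma hermitian_diag_real:
  assumes "A\<^sup>H = A"
  shows "A $ i $ i = complex_of_real (Re (A $ i $ i))"
proof -
  have "cnj (A $ i $ i) = A $ i $ i" by (metis assms ctranspose_nth)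
  then show ?thesis by (simp add: complex_eq_iff)
qed

lemma pos_semidef_diag: "pos_semidef A \<Longrightarrow> 0 \<le> Re (A $ i $ i)"
  unfolding pos_semidef_def by (metis hermitian_form_axis)

lemma pos_def_diag: "pos_def A \<Longrightarrow> 0 < Re (A $ i $ i)"
  unfolding pos_def_def by (metis hermitian_form_axis axis_eq_0_iff zero_neq_one)

lemma pos_semidef_congruence:
  assumes "pos_semidef A"
  shows "pos_semidef (C\<^sup>H ** A ** C)"
  using assms
  by (simp add: pos_semidef_def hermitian_form_congruence ctranspose_mult matrix_mul_assoc)

lemma pos_semidef_gram: "pos_semidef (A ** A\<^sup>H)"
proof -
  have "pos_semidef (mat 1)"
    by (simp add: pos_semidef_def hermitian_form_mat_1 sum_nonneg)
  from pos_semidef_congruence[OF this, of "A\<^sup>H"] show ?thesis by simp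
qed

lemma pos_def_one_plus:
  assumes "pos_semidef A"
  shows "pos_def (mat 1 + A)"
  unfolding pos_def_def
proof (intro conjI allI impI)
  show "(mat 1 + A)\<^sup>H = mat 1 + A"
    using assms by (simp add: pos_semidef_def ctranspose_add)
  fix v :: "complex^'a" assume "v \<noteq> 0"
  then obtain i where "v $ i \<noteq> 0" by (auto simp: vec_eq_iff)
  then have "0 < (\<Sum>i\<in>UNIV. (cmod (v $ i))\<^sup>2)"
    by (intro sum_pos2[of _ i]) auto
  moreover have "0 \<le> Re (hermitian_form A v)"
    using assms by (simp add: pos_semidef_def)
  ultimately show "0 < Re (hermitian_form (mat 1 + A) v)"
    by (simp add: hermitian_form_add hermitian_form_mat_1)
qed

text \<open>The nonzero determinant makes \<open>C\<close> injective, which keeps the form strictly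
  positive on nonzero vectors.\<close>

lemma pos_def_congruence:
  fixes A :: "complex^'n::finite^'n"
  assumes "pos_def A" "det C \<noteq> 0"
  shows "pos_def (C\<^sup>H ** A ** C)"
proof -
  have "\<exists>B. B ** C = mat 1"
    using assms(2) by (metis invertible_det_nz invertible_def)
  then have "C *v v \<noteq> 0" if "v \<noteq> 0" for v
    using that matrix_left_invertible_ker by blast
  then show ?thesis
    using assms(1)
    by (simp add: pos_def_def hermitian_form_congruence ctranspose_mult matrix_mul_assoc)
qed

text \<open>The off-diagonal entries sit in column \<open>k\<close>, so every row of the transpose
  except row \<open>k\<close> is a row of the identity. What remains is the one-by-one principal
  submatrix at \<open>k\<close>, with entry 1.\<close>

lemma det_elimination:
  fixes l :: "'n::finite \<Rightarrow> 'a::comm_ring_1"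
  shows "det (\<chi> i j. if i = j then 1 else if j = k then l i else 0) = (1 :: 'a)"
    (is "det ?L = 1")
proof -
  have "det ?L = det (transpose ?L)"
    by (simp only: det_transpose)
  also have "\<dots> = det (\<chi> (i::1) (j::1). transpose ?L $ k $ k)"
    by (rule det_restrict_identity_rows) (auto simp: transpose_def inj_def)
  finally show ?thesis by (simp add: det_1 transpose_def)
qed

lemma det_diag_entries:
  assumes "\<And>i j. i \<noteq> j \<Longrightarrow> A $ i $ j = 0" and "\<And>i. A $ i $ i = complex_of_real (d i)"
  shows "det A = complex_of_real (\<Prod>i\<in>UNIV. d i)"
  using assms by (simp add: det_diagonal)

text \<open>The set \<open>K\<close> contains all indices of nonzero off-diagonal entries; the induction clears one
  row and column at a time by a unimodular congruence, which can only decrease the diagonal.\<close>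

lemma Hadamard_aux:
  fixes A :: "complex^'n::finite^'n"
  assumes "finite K" "pos_def A" "\<And>i j. i \<noteq> j \<Longrightarrow> i \<notin> K \<or> j \<notin> K \<Longrightarrow> A $ i $ j = 0"
  shows "\<exists>r>0. det A = complex_of_real r \<and> r \<le> (\<Prod>i\<in>UNIV. Re (A $ i $ i))"
  using assms
proof (induction K arbitrary: A rule: finite_induct)
  case empty
  then have "det A = complex_of_real (\<Prod>i\<in>UNIV. Re (A $ i $ i))"
    by (intro det_diag_entries) (auto simp: pos_def_def intro: hermitian_diag_real)
  then show ?case
    using pos_def_diag[OF empty(1)]
    by (intro exI[of _ "\<Prod>i\<in>UNIV. Re (A $ i $ i)"]) (auto intro: prod_pos)
next
  case (insert k K A)
  define a where "a = Re (A $ k $ k)"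
  have a: "a > 0" "A $ k $ k = complex_of_real a"
    using pos_def_diag[OF insert.prems(1)] hermitian_diag_real insert.prems(1)
    unfolding a_def pos_def_def by auto
  \<comment> \<open>Gaussian elimination with pivot \<open>a\<close>: adding \<open>l i\<close>
    times row \<open>k\<close> to row \<open>i\<close> clears entry \<open>(i, k)\<close>, and
    \<open>L\<^sup>H\<close> on the right does the same to the columns.\<close>
  define l where "l i = - (A $ i $ k / a)" for i
  define L :: "complex^'n^'n" where "L = (\<chi> i j. if i = j then 1 else if j = k then l i else 0)"
  define B where "B = L ** A ** L\<^sup>H"
  have herm: "A $ j $ i = cnj (A $ i $ j)" for i j
    using insert.prems(1) unfolding pos_def_def by (metis ctranspose_nth)
  have det_L: "det L = 1" "det (L\<^sup>H) = 1"
  proof -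
    show "det L = 1" unfolding L_def by (rule det_elimination)
    have "L\<^sup>H = transpose (\<chi> i j. if i = j then 1 else if j = k then cnj (l i) else 0)"
      by (auto simp: L_def vec_eq_iff transpose_def)
    then show "det (L\<^sup>H) = 1" by (simp only: det_transpose det_elimination)
  qed
  have det_B: "det B = det A"
    by (simp add: B_def det_mul det_L)
  have pd_B: "pos_def B"
    using pos_def_congruence[of A "L\<^sup>H"] insert.prems(1) det_L by (simp add: B_def)
  have LA: "(L ** A) $ i $ j = A $ i $ j + (if i = k then 0 else l i * A $ k $ j)" for i j
  proof -
    have "(L ** A) $ i $ j =
        (\<Sum>m\<in>UNIV. (if m = i then A $ i $ j else 0) + (if m = k then if i = k then 0 else l i * A $ k $ j else 0))"
      unfolding matrix_matrix_mult_def L_def vec_lambda_beta by (rule sum.cong) auto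
    then show ?thesis by (simp add: sum.distrib)
  qed
  have XL: "(X ** L\<^sup>H) $ i $ j = X $ i $ j + (if j = k then 0 else X $ i $ k * cnj (l j))" for X i j
  proof -
    have "(X ** L\<^sup>H) $ i $ j =
        (\<Sum>m\<in>UNIV. (if m = j then X $ i $ j else 0) + (if m = k then if j = k then 0 else X $ i $ k * cnj (l j) else 0))"
      unfolding matrix_matrix_mult_def L_def vec_lambda_beta by (rule sum.cong) auto
    then show ?thesis by (simp add: sum.distrib)
  qed
  have B_k: "B $ i $ k = 0" "B $ k $ i = 0" if "i \<noteq> k" for i
    using a that by (simp_all add: B_def LA XL l_def herm[of i k])
  \<comment> \<open>Away from row and column \<open>k\<close> this is the Schur complement of the
    pivot.\<close>
  have B_other: "B $ i $ j = A $ i $ j - A $ i $ k * A $ k $ j / a" if "i \<noteq> k" for i j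
    using a that by (simp add: B_def LA XL l_def)
  \<comment> \<open>By hermiticity the amount subtracted on the diagonal is
    \<open>(cmod (A $ i $ k))\<^sup>2 / a\<close>, which is nonnegative.\<close>
  have B_diag: "Re (B $ i $ i) \<le> Re (A $ i $ i)" for i
  proof (cases "i = k")
    case True
    then show ?thesis by (simp add: B_def LA XL)
  next
    case False
    have "A $ i $ k * A $ k $ i = complex_of_real ((cmod (A $ i $ k))\<^sup>2)"
      unfolding herm[of k i] complex_norm_square ..
    then show ?thesis
      using a by (simp add: B_other[OF False] del: of_real_power flip: of_real_divide)
  qed
  have "\<exists>r>0. det B = complex_of_real r \<and> r \<le> (\<Prod>i\<in>UNIV. Re (B $ i $ i))"
  proof (rule insert.IH[OF pd_B])
    fix i j assume ij: "i \<noteq> j" "i \<notin> K \<or> j \<notin> K"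
    show "B $ i $ j = 0"
    proof (cases "i = k \<or> j = k")
      case True
      then show ?thesis using B_k ij by auto
    next
      case False
      \<comment> \<open>Elimination causes no fill-in outside \<open>K\<close>: an index outside
        \<open>insert k K\<close> makes its own factor of the subtracted product vanish.\<close>
      then have "A $ i $ j = 0" "A $ i $ k = 0 \<or> A $ k $ j = 0"
        using ij insert.prems(2)[of i j] insert.prems(2)[of i k] insert.prems(2)[of k j] by auto
      then show ?thesis using False by (auto simp: B_other)
    qed
  qed
  moreover have "(\<Prod>i\<in>UNIV. Re (B $ i $ i)) \<le> (\<Prod>i\<in>UNIV. Re (A $ i $ i))"
    by (intro prod_mono) (use B_diag pos_def_diag[OF pd_B] in \<open>auto intro: less_imp_le\<close>)
  ultimately show ?case unfolding det_B by force
qed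

lemma Hadamard_inequality:
  fixes A :: "complex^'n::finite^'n"
  assumes "pos_def A"
  obtains r where "r > 0" "det A = complex_of_real r" "r \<le> (\<Prod>i\<in>UNIV. Re (A $ i $ i))"
  using Hadamard_aux[of UNIV A] assms by auto

section \<open>Covariance of the transmit signal\<close>

lemma trace_gram_swap: "trace (A ** A\<^sup>H) = trace (A\<^sup>H ** A)" for A :: "complex^'n::finite^'m::finite"
  by (rule trace_mul_sym)

text \<open>Blocks of different subcarriers occupy disjoint rows, so their columns are orthogonal.
  This is the constraint that limits which covariances a signal can have.\<close>

lemma gram_data_matrix_nth:
  "((data_matrix B)\<^sup>H ** data_matrix B) $ i $ j =
    (if fst i = fst j then \<Sum>x\<in>UNIV. cnj (B $ fst i $ x $ snd i) * B $ fst j $ x $ snd j else 0)"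
proof -
  have "((data_matrix B)\<^sup>H ** data_matrix B) $ i $ j =
      (\<Sum>q\<in>UNIV. \<Sum>x\<in>UNIV. if q = fst i \<and> q = fst j
        then cnj (B $ fst i $ x $ snd i) * B $ fst j $ x $ snd j else 0)"
    unfolding sum.cartesian_product
    by (auto simp: data_matrix_def block_diag_def matrix_matrix_mult_def intro!: sum.cong)
  also have "\<dots> = (\<Sum>q\<in>UNIV. if q = fst i then
      (if fst i = fst j then \<Sum>x\<in>UNIV. cnj (B $ fst i $ x $ snd i) * B $ fst j $ x $ snd j else 0) else 0)"
    by (rule sum.cong) auto
  finally show ?thesis by simp
qed

text \<open>Each entry is a polynomial in the symbols and their conjugates, hence continuous.
  Measurability is what allows integration against a pushforward law.\<close>

lemma borel_measurable_gram_data_matrix: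
  "(\<lambda>B :: ('c::finite, 't::finite, 'x::finite) blocks. (data_matrix B)\<^sup>H ** data_matrix B)
    \<in> borel_measurable borel"
proof (rule borel_measurable_continuous_onI)
  have "continuous_on UNIV (\<lambda>B :: ('c, 't, 'x) blocks.
      ((data_matrix B)\<^sup>H ** data_matrix B) $ i $ j)" for i j
    unfolding gram_data_matrix_nth by (cases "fst i = fst j") (auto intro!: continuous_intros)
  then have "continuous_on UNIV (\<lambda>B :: ('c, 't, 'x) blocks.
      \<chi> i j. ((data_matrix B)\<^sup>H ** data_matrix B) $ i $ j)"
    by (intro continuous_on_vec_lambda)
  then show "continuous_on UNIV
      (\<lambda>B :: ('c, 't, 'x) blocks. (data_matrix B)\<^sup>H ** data_matrix B)"
    by simp
qed

text \<open>Expectation commutes with bounded linear maps. Linearity is over the reals, so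
  \<open>f\<close> may involve conjugation and real parts; hermiticity, positivity and the trace of
  the covariance all come from choices of \<open>f\<close>.\<close>

lemma integral_bounded_linear_Sigma_X:
  fixes P :: "('c::finite, 't::finite, 'x::finite) blocks measure"
  assumes "tx_signal P" "bounded_linear f"
  shows "f (Sigma_X P) =
    (1 / real CARD('x)) *\<^sub>R (\<integral>B. f ((data_matrix B)\<^sup>H ** data_matrix B) \<partial>P)"
proof -
  have "integrable P (\<lambda>B. (data_matrix B)\<^sup>H ** data_matrix B)"
    using assms(1) by (simp add: tx_signal_def)
  from integral_bounded_linear[OF assms(2) this] show ?thesis
    by (simp add: Sigma_X_def linear_scale[OF bounded_linear.linear[OF assms(2)]])
qed

lemma pos_semidef_Sigma_X:
  fixes P :: "('c::finite, 't::finite, 'x::finite) blocks measure"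
  assumes "tx_signal P"
  shows "pos_semidef (Sigma_X P)"
  unfolding pos_semidef_def
proof (intro conjI allI)
  have entry: "bounded_linear (\<lambda>M :: complex^('c \<times> 't)^('c \<times> 't). M $ i $ j)" for i j
    using bounded_linear_compose[OF bounded_linear_vec_nth bounded_linear_vec_nth] by blast
  have "cnj (Sigma_X P $ j $ i) = Sigma_X P $ i $ j" for i j
  proof -
    have "cnj (Sigma_X P $ j $ i) = (1 / real CARD('x)) *\<^sub>R
        (\<integral>B. cnj (((data_matrix B)\<^sup>H ** data_matrix B) $ j $ i) \<partial>P)"
      by (rule integral_bounded_linear_Sigma_X[OF assms])
         (rule bounded_linear_compose[OF bounded_linear_cnj entry])
    also have "\<dots> = (1 / real CARD('x)) *\<^sub>R
        (\<integral>B. ((data_matrix B)\<^sup>H ** data_matrix B) $ i $ j \<partial>P)"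
      by (simp only: gram_data_matrix_nth) (simp add: if_distrib[of cnj] eq_commute mult.commute cong: if_cong)
    also have "\<dots> = Sigma_X P $ i $ j"
      by (rule integral_bounded_linear_Sigma_X[OF assms entry, symmetric])
    finally show ?thesis .
  qed
  then show "(Sigma_X P)\<^sup>H = Sigma_X P" by (simp add: vec_eq_iff)
  fix v :: "complex^('c \<times> 't)"
  have lin: "bounded_linear (\<lambda>M :: complex^('c \<times> 't)^('c \<times> 't). Re (hermitian_form M v))"
    unfolding hermitian_form_def
    by (intro bounded_linear_compose[OF bounded_linear_Re] bounded_linear_sum
        bounded_linear_compose[OF bounded_linear_mult_left]
        bounded_linear_compose[OF bounded_linear_mult_right] entry)
  have "0 \<le> Re (hermitian_form ((data_matrix B)\<^sup>H ** data_matrix B) v)" for B :: "('c, 't, 'x) blocks"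
    using pos_semidef_gram[of "(data_matrix B)\<^sup>H"] by (simp add: pos_semidef_def)
  then show "0 \<le> Re (hermitian_form (Sigma_X P) v)"
    by (simp add: integral_bounded_linear_Sigma_X[OF assms lin])
qed

lemma avg_power_eq_trace:
  fixes P :: "('c::finite, 't::finite, 'x::finite) blocks measure"
  assumes "tx_signal P"
  shows "avg_power P = Re (trace (Sigma_X P))"
proof -
  have "bounded_linear (\<lambda>M :: complex^('c \<times> 't)^('c \<times> 't). Re (trace M))"
    unfolding trace_def
    by (intro bounded_linear_compose[OF bounded_linear_Re] bounded_linear_sum
        bounded_linear_compose[OF bounded_linear_vec_nth bounded_linear_vec_nth])
  from integral_bounded_linear_Sigma_X[OF assms this]
  show ?thesis by (simp add: avg_power_def trace_gram_swap)
qed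

lemma unitary_matrix_cancel:
  assumes "unitary_matrix U"
  shows "U\<^sup>H ** (U ** X) = X" "U ** (U\<^sup>H ** X) = X" "U\<^sup>H ** U = mat 1" "U ** U\<^sup>H = mat 1"
  using assms by (simp_all add: unitary_matrix_def matrix_mul_assoc)

lemma trace_S_matrix:
  assumes "unitary_matrix U"
  shows "trace (S_matrix U P) = trace (Sigma_X P)"
proof -
  have "trace (S_matrix U P) = trace (U ** (U\<^sup>H ** Sigma_X P))"
    unfolding S_matrix_def by (rule trace_mul_sym)
  then show ?thesis using assms by (simp add: matrix_mul_assoc unitary_matrix_def)
qed

text \<open>A single transmitted row, drawn uniformly from the rows of \<open>W\<close>, has second moment
  proportional to the Gram matrix of \<open>W\<close>; hence no relation between the numbers of symbols and of
  antennas is required.\<close>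

lemma tx_signal_with_covariance:
  fixes W :: "complex^('c::finite \<times> 't::finite)^('k::finite)"
  assumes blocks: "\<And>i j. fst i \<noteq> fst j \<Longrightarrow> (W\<^sup>H ** W) $ i $ j = 0"
  obtains P :: "('c, 't, 'x::finite) blocks measure"
    where "tx_signal P" "Sigma_X P = W\<^sup>H ** W"
proof -
  \<comment> \<open>\<open>c\<^sup>2\<close> cancels two averages: the factor
    \<open>1 / CARD('x)\<close> in \<open>Sigma_X\<close> and the uniform weight
    \<open>1 / CARD('k)\<close> of a row.\<close>
  define c where "c = sqrt (real CARD('x) * real CARD('k))"
  define x\<^sub>0 :: 'x where "x\<^sub>0 = undefined"
  \<comment> \<open>Row \<open>k\<close> of \<open>W\<close> is cut into one segment per subcarrier.
    The segments land in different rows of the data matrix, so products across subcarriers are lost;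
    the hypothesis \<open>blocks\<close> says that they average to zero anyway.\<close>
  define X :: "'k \<Rightarrow> ('c, 't, 'x) blocks"
    where "X k = (\<chi> p x t. if x = x\<^sub>0 then complex_of_real c * W $ k $ (p, t) else 0)" for k
  define P where "P = distr (measure_pmf (pmf_of_set UNIV)) borel X"
  let ?G = "\<lambda>B :: ('c, 't, 'x) blocks. (data_matrix B)\<^sup>H ** data_matrix B"
  have gram: "?G (X k) $ i $ j =
      (if fst i = fst j then complex_of_real (c\<^sup>2) * (cnj (W $ k $ i) * W $ k $ j) else 0)" for k i j
  proof -
    have "(\<Sum>x\<in>UNIV. cnj (X k $ fst i $ x $ snd i) * X k $ fst j $ x $ snd j) =
        (\<Sum>x\<in>UNIV. if x = x\<^sub>0 then complex_of_real (c\<^sup>2) * (cnj (W $ k $ i) * W $ k $ j) else 0)"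
      by (rule sum.cong) (auto simp: X_def power2_eq_square)
    also have "\<dots> = complex_of_real (c\<^sup>2) * (cnj (W $ k $ i) * W $ k $ j)" by simp
    finally show ?thesis unfolding gram_data_matrix_nth by (simp only:)
  qed
  have "integrable (measure_pmf (pmf_of_set UNIV)) (\<lambda>k. ?G (X k))"
    by (rule integrable_measure_pmf_finite) simp
  then have "integrable P ?G"
    unfolding P_def by (subst integrable_distr_eq) (auto simp: borel_measurable_gram_data_matrix)
  moreover have "prob_space P"
    unfolding P_def by (rule measure_pmf.prob_space_distr) simp
  ultimately have "tx_signal P" by (simp add: tx_signal_def P_def)
  moreover have "Sigma_X P = W\<^sup>H ** W"
  proof -
    have "(\<integral>B. ?G B \<partial>P) = (\<integral>k. ?G (X k) \<partial>measure_pmf (pmf_of_set UNIV))"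
      unfolding P_def by (subst integral_distr) (auto simp: borel_measurable_gram_data_matrix)
    also have "\<dots> = (\<Sum>k\<in>UNIV. (1 / real CARD('k)) *\<^sub>R ?G (X k))"
      by (subst integral_measure_pmf[of UNIV]) auto
    finally have S: "Sigma_X P $ i $ j =
        (1 / real CARD('x)) *\<^sub>R (\<Sum>k\<in>UNIV. (1 / real CARD('k)) *\<^sub>R ?G (X k) $ i $ j)" for i j
      by (simp add: Sigma_X_def)
    have "Sigma_X P $ i $ j = (W\<^sup>H ** W) $ i $ j" for i j
    proof (cases "fst i = fst j")
      case True
      then show ?thesis
        unfolding S gram
        by (simp add: c_def matrix_matrix_mult_def scaleR_conv_of_real sum_distrib_left[symmetric])
    next
      case False
      then show ?thesis unfolding S gram by (simp add: blocks)
    qed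
    then show ?thesis by (simp add: vec_eq_iff)
  qed
  ultimately show ?thesis using that by blast
qed

section \<open>Spectral decomposition of the channel\<close>

text \<open>\<open>U\<close> need not be block diagonal when an eigenvalue occurs in several blocks; but the block
  projections commute with the decomposed matrix and hence with every function of it.\<close>

lemma functional_calculus_block_diagonal:
  fixes K :: "complex^('c::finite \<times> 't::finite)^('c \<times> 't)"
  assumes U: "unitary_matrix U" and K: "K = U ** diag_matrix \<mu> ** U\<^sup>H"
    and blocks: "\<And>i j. fst i \<noteq> fst j \<Longrightarrow> K $ i $ j = 0"
    and "fst i \<noteq> fst j"
  shows "(U ** diag_matrix (\<lambda>i. g (\<mu> i)) ** U\<^sup>H) $ i $ j = 0"
proof -
  note cancel = unitary_matrix_cancel[OF U]
  \<comment> \<open>\<open>D\<close> projects onto the subcarrier of \<open>i\<close>;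
    \<open>V\<close> is the same projection written in the eigenbasis.\<close>
  define D :: "complex^('c \<times> 't)^('c \<times> 't)"
    where "D = diag_matrix (\<lambda>k. if fst k = fst i then 1 else 0)"
  define V where "V = U\<^sup>H ** D ** U"
  have "D ** K = K ** D"
    using blocks by (auto simp: vec_eq_iff D_def diag_matrix_mult_nth matrix_mult_diag_nth)
  then have "U\<^sup>H ** (D ** (U ** diag_matrix \<mu> ** U\<^sup>H)) ** U =
      U\<^sup>H ** ((U ** diag_matrix \<mu> ** U\<^sup>H) ** D) ** U"
    by (simp add: K)
  then have "V ** diag_matrix \<mu> = diag_matrix \<mu> ** V"
    by (simp add: V_def cancel flip: matrix_mul_assoc)
  then have "V $ a $ b * complex_of_real (\<mu> b) = complex_of_real (\<mu> a) * V $ a $ b" for a b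
    by (simp flip: diag_matrix_mult_nth matrix_mult_diag_nth)
  \<comment> \<open>Commuting with \<open>diag_matrix \<mu>\<close> confines \<open>V\<close> to
    index pairs with equal eigenvalues, on which \<open>g\<close> also takes equal values.\<close>
  then have V: "V $ a $ b = 0 \<or> \<mu> a = \<mu> b" for a b
    by (metis mult.commute mult_cancel_left of_real_eq_iff)
  have "V $ a $ b * complex_of_real (g (\<mu> b)) = complex_of_real (g (\<mu> a)) * V $ a $ b" for a b
    using V[of a b] by auto
  then have comm: "V ** diag_matrix (\<lambda>i. g (\<mu> i)) = diag_matrix (\<lambda>i. g (\<mu> i)) ** V"
    by (simp add: vec_eq_iff diag_matrix_mult_nth matrix_mult_diag_nth)
  let ?G = "U ** diag_matrix (\<lambda>i. g (\<mu> i)) ** U\<^sup>H"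
  have UV: "U ** V = D ** U" "V ** U\<^sup>H = U\<^sup>H ** D"
    by (simp_all add: V_def cancel flip: matrix_mul_assoc)
  have "D ** ?G = (D ** U) ** diag_matrix (\<lambda>i. g (\<mu> i)) ** U\<^sup>H"
    by (simp add: matrix_mul_assoc)
  also have "\<dots> = U ** (V ** diag_matrix (\<lambda>i. g (\<mu> i))) ** U\<^sup>H"
    by (simp add: matrix_mul_assoc flip: UV)
  also have "\<dots> = U ** diag_matrix (\<lambda>i. g (\<mu> i)) ** (V ** U\<^sup>H)"
    by (simp add: comm matrix_mul_assoc)
  also have "\<dots> = ?G ** D"
    by (simp add: UV matrix_mul_assoc)
  finally have "D ** ?G = ?G ** D" .
  \<comment> \<open>\<open>D\<close> has diagonal entry 1 at \<open>i\<close> and 0 at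
    \<open>j\<close>: the left entry is that of \<open>?G\<close>, the right one is 0.\<close>
  then have "(D ** ?G) $ i $ j = (?G ** D) $ i $ j" by simp
  then show ?thesis
    using assms(4) by (simp add: D_def diag_matrix_mult_nth matrix_mult_diag_nth)
qed

lemma block_diag_mult_ctranspose_nth:
  assumes "fst i \<noteq> fst j"
  shows "(block_diag H ** (block_diag H)\<^sup>H) $ i $ j = 0"
  using assms by (auto simp: matrix_matrix_mult_def block_diag_def intro!: sum.neutral)

text \<open>\<open>diag_matrix \<mu>\<close> is a congruence of a Gram matrix. The sign of
  \<open>\<mu>\<close> thus follows from the decomposition instead of being assumed.\<close>

lemma eigenvalues_gram_nonneg:
  assumes "unitary_matrix U" "A ** A\<^sup>H = U ** diag_matrix \<mu> ** U\<^sup>H"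
  shows "0 \<le> \<mu> i"
proof -
  have "U\<^sup>H ** (A ** A\<^sup>H) ** U = diag_matrix \<mu>"
    unfolding assms(2) by (simp add: unitary_matrix_cancel[OF assms(1)] flip: matrix_mul_assoc)
  moreover have "pos_semidef (U\<^sup>H ** (A ** A\<^sup>H) ** U)"
    by (intro pos_semidef_congruence pos_semidef_gram)
  ultimately show ?thesis using pos_semidef_diag[of "diag_matrix \<mu>" i] by (simp add: diag_matrix_nth)
qed

lemma mat_mult_nth: "(mat c ** A) $ i $ j = c * A $ i $ j" for A :: "complex^'n::finite^'m::finite"
  by (simp add: matrix_matrix_mult_def mat_def if_distrib[of "\<lambda>x. x * _"] cong: if_cong)

lemma mult_mat_nth: "(A ** mat c) $ i $ j = A $ i $ j * c" for A :: "complex^'n::finite^'m::finite"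
  by (simp add: matrix_matrix_mult_def mat_def if_distrib[of "\<lambda>x. _ * x"] cong: if_cong)

lemma det_mat: "det (mat c :: complex^'n::finite^'n) = c ^ CARD('n)"
  by (subst det_diagonal) (auto simp: mat_def)

text \<open>Extracting \<open>s\<close> from a matrix of size \<open>CARD('r)\<close> yields the
  power that later cancels the prefactor of the mutual information. One exchange of factors produces
  \<open>A A\<^sup>H / s = (U D) (D U\<^sup>H)\<close>; a second one moves \<open>U D\<close> to the
  right end.\<close>

lemma det_scaled_congruence:
  fixes A :: "complex^'r::finite^'n::finite" and U :: "complex^'n^'n"
  assumes "s > 0" and U: "unitary_matrix U"
    and spectral: "A ** A\<^sup>H = U ** diag_matrix \<mu> ** U\<^sup>H"
  defines "D \<equiv> diag_matrix (\<lambda>i. sqrt (\<mu> i / s))"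
  shows "det (A\<^sup>H ** Q ** A + mat (complex_of_real s)) =
    complex_of_real s ^ CARD('r) * det (mat 1 + D ** (U\<^sup>H ** Q ** U) ** D)"
proof -
  let ?c = "complex_of_real (1 / s)"
  have nonneg: "0 \<le> \<mu> i" for i by (rule eigenvalues_gram_nonneg[OF U spectral])
  have DD: "mat ?c ** (A ** A\<^sup>H) = (U ** D) ** (D ** U\<^sup>H)"
  proof -
    have "D ** D = mat ?c ** diag_matrix \<mu>"
      using \<open>s > 0\<close> nonneg
      by (simp add: D_def diag_matrix_mult_diag_matrix vec_eq_iff mat_mult_nth diag_matrix_nth)
    moreover have "mat ?c ** U = U ** mat ?c"
      by (simp add: vec_eq_iff mat_mult_nth mult_mat_nth)
    then have "mat ?c ** (U ** diag_matrix \<mu> ** U\<^sup>H) = U ** (mat ?c ** diag_matrix \<mu>) ** U\<^sup>H"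
      by (simp add: matrix_mul_assoc)
    ultimately have "mat ?c ** (U ** diag_matrix \<mu> ** U\<^sup>H) = U ** (D ** D) ** U\<^sup>H"
      by simp
    then show ?thesis
      unfolding spectral by (simp add: matrix_mul_assoc)
  qed
  have "A\<^sup>H ** Q ** A + mat (complex_of_real s) =
      mat (complex_of_real s) ** (mat 1 + (A\<^sup>H ** Q) ** (mat ?c ** A))"
  proof -
    have "(A\<^sup>H ** Q) ** (mat ?c ** A) = mat ?c ** (A\<^sup>H ** Q ** A)"
    proof -
      have "(A\<^sup>H ** Q) ** mat ?c = mat ?c ** (A\<^sup>H ** Q)"
        by (simp add: vec_eq_iff mat_mult_nth mult_mat_nth)
      then show ?thesis by (simp add: matrix_mul_assoc)
    qed
    then show ?thesis
      using \<open>s > 0\<close> by (simp add: vec_eq_iff mat_mult_nth algebra_simps) (simp add: mat_def)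
  qed
  then have "det (A\<^sup>H ** Q ** A + mat (complex_of_real s)) =
      complex_of_real s ^ CARD('r) * det (mat 1 + (A\<^sup>H ** Q) ** (mat ?c ** A))"
    by (simp only: det_mul det_mat)
  also have "det (mat 1 + (A\<^sup>H ** Q) ** (mat ?c ** A)) = det (mat 1 + (mat ?c ** A) ** (A\<^sup>H ** Q))"
    by (rule det_one_plus_mult_commute)
  also have "(mat ?c ** A) ** (A\<^sup>H ** Q) = (U ** D) ** (D ** U\<^sup>H ** Q)"
    using arg_cong[OF DD, of "\<lambda>M. M ** Q"] by (simp add: matrix_mul_assoc)
  also have "det (mat 1 + (U ** D) ** (D ** U\<^sup>H ** Q)) = det (mat 1 + (D ** U\<^sup>H ** Q) ** (U ** D))"
    by (rule det_one_plus_mult_commute)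
  finally show ?thesis by (simp add: matrix_mul_assoc)
qed

section \<open>Water filling\<close>

text \<open>The allocation in terms of the water level \<open>w\<close>: it is continuous and
  nondecreasing in \<open>w\<close> across 0, whereas \<open>- 1 / (\<beta> * ln 2)\<close> is
  discontinuous at \<open>\<beta> = 0\<close>.\<close>

definition water_filling :: "real \<Rightarrow> ('n \<Rightarrow> real) \<Rightarrow> real \<Rightarrow> 'n \<Rightarrow> real"
  where "water_filling \<sigma> \<mu> w i = (if \<mu> i \<noteq> 0 then max (w - \<sigma>\<^sup>2 / \<mu> i) 0 else 0)"

lemma alloc_eq_water_filling: "alloc \<sigma> \<mu> \<beta> = water_filling \<sigma> \<mu> (- 1 / (\<beta> * ln 2))"
  by (simp add: fun_eq_iff alloc_def water_filling_def)

lemma alloc_nonneg: "0 \<le> alloc \<sigma> \<mu> \<beta> i"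
  by (simp add: alloc_def)

lemma water_filling_nonpos_level:
  assumes "\<And>i. 0 \<le> \<mu> i" "w \<le> 0"
  shows "water_filling \<sigma> \<mu> w i = 0"
proof -
  have "w - \<sigma>\<^sup>2 / \<mu> i \<le> 0"
    using assms(2) divide_nonneg_nonneg[OF zero_le_power2[of \<sigma>] assms(1)[of i]] by linarith
  then show ?thesis by (simp add: water_filling_def)
qed

text \<open>A positive sum has an index already above its floor
  \<open>\<sigma>\<^sup>2 / \<mu> i\<close>, and its share grows strictly. At lower levels the sum
  can be constantly 0.\<close>

lemma sum_water_filling_strict_mono:
  assumes "w < w'" "0 < (\<Sum>i\<in>UNIV. water_filling \<sigma> \<mu> w (i :: 'n::finite))"
  shows "(\<Sum>i\<in>UNIV. water_filling \<sigma> \<mu> w i) < (\<Sum>i\<in>UNIV. water_filling \<sigma> \<mu> w' i)"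
proof (rule sum_strict_mono_ex1)
  obtain i where "0 < water_filling \<sigma> \<mu> w i"
    using assms(2) by (meson less_le_not_le not_le sum_nonpos)
  then have "water_filling \<sigma> \<mu> w i < water_filling \<sigma> \<mu> w' i"
    using assms(1) by (auto simp: water_filling_def max_def split: if_splits)
  then show "\<exists>i\<in>UNIV. water_filling \<sigma> \<mu> w i < water_filling \<sigma> \<mu> w' i" by blast
  show "\<forall>i\<in>UNIV. water_filling \<sigma> \<mu> w i \<le> water_filling \<sigma> \<mu> w' i"
    using assms(1) by (auto simp: water_filling_def)
qed simp

text \<open>For \<open>\<beta> \<ge> 0\<close> the water level is at most 0, including
  \<open>\<beta> = 0\<close>, where the quotient is 0 by convention; nothing would be allocated
  although \<open>E > 0\<close>.\<close>

lemma multiplier_neg: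
  fixes \<mu> :: "'n::finite \<Rightarrow> real"
  assumes "\<And>i. 0 \<le> \<mu> i" "E > 0" "(\<Sum>i\<in>UNIV. alloc \<sigma> \<mu> \<beta> i) = E"
  shows "\<beta> < 0"
proof (rule ccontr)
  assume "\<not> \<beta> < 0"
  then have "- 1 / (\<beta> * ln 2) \<le> 0" by (simp add: divide_le_0_iff)
  then have "(\<Sum>i\<in>UNIV. alloc \<sigma> \<mu> \<beta> i) = 0"
    unfolding alloc_eq_water_filling by (intro sum.neutral ballI water_filling_nonpos_level assms(1))
  then show False using assms by simp
qed

lemma ex1_multiplier:
  fixes \<mu> :: "'n::finite \<Rightarrow> real"
  assumes nonneg: "\<And>i. 0 \<le> \<mu> i" and "E > 0" and "\<mu> k \<noteq> 0"
  shows "\<exists>!\<beta>. (\<Sum>i\<in>UNIV. alloc \<sigma> \<mu> \<beta> i) = E"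
proof -
  let ?f = "\<lambda>w. \<Sum>i\<in>UNIV. water_filling \<sigma> \<mu> w i"
  \<comment> \<open>At this level index \<open>k\<close> alone receives \<open>E\<close>, while
    level 0 allocates nothing; the intermediate value theorem gives a level between.\<close>
  let ?b = "E + \<sigma>\<^sup>2 / \<mu> k"
  have "?f 0 = 0" by (simp add: water_filling_nonpos_level nonneg)
  have "E \<le> water_filling \<sigma> \<mu> ?b k"
    using assms by (simp add: water_filling_def)
  also have "\<dots> \<le> ?f ?b"
    by (rule member_le_sum) (auto simp: water_filling_def)
  finally have "E \<le> ?f ?b" .
  moreover have "continuous_on {0..?b} (\<lambda>w. water_filling \<sigma> \<mu> w i)" for i
    unfolding water_filling_def by (cases "\<mu> i = 0") (auto intro!: continuous_intros)
  then have "continuous_on {0..?b} ?f"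
    by (intro continuous_on_sum)
  ultimately obtain w where w: "0 \<le> w" "?f w = E"
    using IVT'[of ?f 0 E ?b] \<open>?f 0 = 0\<close> \<open>E > 0\<close> nonneg[of k] by auto
  have "w \<noteq> 0" using w \<open>?f 0 = 0\<close> \<open>E > 0\<close> by auto
  then have "(\<Sum>i\<in>UNIV. alloc \<sigma> \<mu> (- 1 / (w * ln 2)) i) = E"
    using w by (simp add: alloc_eq_water_filling)
  moreover have "\<beta> = \<beta>'"
    if "(\<Sum>i\<in>UNIV. alloc \<sigma> \<mu> \<beta> i) = E" "(\<Sum>i\<in>UNIV. alloc \<sigma> \<mu> \<beta>' i) = E" for \<beta> \<beta>'
  proof -
    \<comment> \<open>Both levels give the positive sum \<open>E\<close>, so strict monotonicity
      forces them to be equal; negative multipliers are determined by their levels.\<close>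
    have "- 1 / (\<beta> * ln 2) = - 1 / (\<beta>' * ln 2)"
      using sum_water_filling_strict_mono[of "- 1 / (\<beta> * ln 2)" "- 1 / (\<beta>' * ln 2)" \<sigma> \<mu>]
        sum_water_filling_strict_mono[of "- 1 / (\<beta>' * ln 2)" "- 1 / (\<beta> * ln 2)" \<sigma> \<mu>]
        that \<open>E > 0\<close>
      unfolding alloc_eq_water_filling by linarith
    moreover have "\<beta> < 0" "\<beta>' < 0" using multiplier_neg nonneg \<open>E > 0\<close> that by blast+
    ultimately show ?thesis by (simp add: field_simps)
  qed
  ultimately show ?thesis by blast
qed

text \<open>The derivative of \<open>log 2 (\<mu> * s / \<sigma>\<^sup>2 + 1)\<close> at the allocated power is at most \<open>- \<beta>\<close>,
  with equality when that power is positive.\<close>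

lemma alloc_stationary:
  assumes "0 \<le> \<mu> i" "\<sigma> > 0" "\<beta> < 0"
  defines "d \<equiv> \<mu> i / ((\<mu> i * alloc \<sigma> \<mu> \<beta> i + \<sigma>\<^sup>2) * ln 2)"
  shows "d \<le> - \<beta>" "0 < alloc \<sigma> \<mu> \<beta> i \<Longrightarrow> d = - \<beta>"
proof -
  define w where "w = - 1 / (\<beta> * ln 2)"
  have w: "0 < w" "- \<beta> = 1 / (w * ln 2)"
    using assms(3) by (auto simp: w_def field_simps zero_less_divide_iff mult_less_0_iff)
  have alloc: "alloc \<sigma> \<mu> \<beta> i = water_filling \<sigma> \<mu> w i"
    unfolding w_def alloc_eq_water_filling ..
  have "d \<le> - \<beta> \<and> (0 < alloc \<sigma> \<mu> \<beta> i \<longrightarrow> d = - \<beta>)"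
  proof (cases "\<mu> i = 0")
    case True
    then show ?thesis using assms by (simp add: alloc_def)
  next
    case False
    then have \<mu>: "0 < \<mu> i" using assms(1) by simp
    show ?thesis
    proof (cases "\<sigma>\<^sup>2 / \<mu> i < w")
      \<comment> \<open>Above the floor the denominator becomes \<open>\<mu> i * w\<close>, so the
        slope is \<open>1 / (w * ln 2)\<close> whatever \<open>\<mu> i\<close> is.\<close>
      case True
      then have "alloc \<sigma> \<mu> \<beta> i = w - \<sigma>\<^sup>2 / \<mu> i"
        using \<mu> by (simp add: alloc water_filling_def)
      then have "\<mu> i * alloc \<sigma> \<mu> \<beta> i + \<sigma>\<^sup>2 = \<mu> i * w"
        using \<mu> by (simp add: field_simps)
      then show ?thesis using \<mu> by (simp add: d_def w)
    next
      case False
      then have a: "alloc \<sigma> \<mu> \<beta> i = 0"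
        using \<mu> by (simp add: alloc water_filling_def)
      have "\<mu> i / (\<sigma>\<^sup>2 * ln 2) \<le> 1 / (w * ln 2)"
        using False \<mu> w(1) assms(2) by (simp add: field_simps)
      then show ?thesis by (simp add: d_def a w)
    qed
  qed
  then show "d \<le> - \<beta>" "0 < alloc \<sigma> \<mu> \<beta> i \<Longrightarrow> d = - \<beta>" by auto
qed

section \<open>Optimality of the water-filling allocation\<close>

lemma ln_le_tangent_strict:
  fixes x y :: real
  assumes "0 < x" "0 < y" "x \<noteq> y"
  shows "ln x < ln y + (x - y) / y"
proof -
  have "ln (x / y) \<le> x / y - 1" using assms by (intro ln_le_minus_one) simp
  moreover have "ln (x / y) \<noteq> x / y - 1"
    using ln_eq_minus_one[of "x / y"] assms by auto
  ultimately show ?thesis using assms by (simp add: ln_div diff_divide_distrib)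
qed

lemma log_le_alloc_tangent_strict:
  assumes "0 \<le> \<mu> i" "\<sigma> > 0" "\<beta> < 0" "0 \<le> t" "t \<noteq> alloc \<sigma> \<mu> \<beta> i"
  defines "a \<equiv> alloc \<sigma> \<mu> \<beta> i"
  shows "log 2 (\<mu> i * t / \<sigma>\<^sup>2 + 1) < log 2 (\<mu> i * a / \<sigma>\<^sup>2 + 1) - \<beta> * (t - a)"
proof -
  have a: "0 \<le> a" "t \<noteq> a" using assms by (auto simp: alloc_nonneg)
  define d where "d = \<mu> i / ((\<mu> i * a + \<sigma>\<^sup>2) * ln 2)"
  note stat = alloc_stationary[where \<mu> = \<mu> and i = i and \<sigma> = \<sigma> and \<beta> = \<beta>, OF assms(1-3),
      folded a_def, folded d_def]
  \<comment> \<open>Complementary slackness: either \<open>a = 0\<close>, and \<open>t - a\<close>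
    is nonnegative, or \<open>a > 0\<close>, and the two slopes coincide.\<close>
  have d_le: "d * (t - a) \<le> - \<beta> * (t - a)"
  proof (cases "a = 0")
    case True
    then show ?thesis using mult_right_mono[OF stat(1) assms(4)] by simp
  next
    case False
    then show ?thesis using stat(2) a by simp
  qed
  show ?thesis
  proof (cases "\<mu> i = 0")
    case True
    \<comment> \<open>Both logarithms vanish here; strictness comes from the positive price
      \<open>- \<beta> * t\<close> of power spent on a dead channel.\<close>
    then have "a = 0" by (simp add: a_def alloc_def)
    then show ?thesis using True a assms(3,4) by (simp add: mult_neg_pos)
  next
    case False
    then have \<mu>: "0 < \<mu> i" using assms(1) by simp
    let ?x = "\<mu> i * t / \<sigma>\<^sup>2 + 1" and ?y = "\<mu> i * a / \<sigma>\<^sup>2 + 1"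
    have pos: "0 < ?x" "0 < ?y" "?x \<noteq> ?y"
      using \<mu> a assms(2,4) by (auto intro!: add_nonneg_pos)
    have den: "\<mu> i * a + \<sigma>\<^sup>2 > 0" using \<mu> a assms(2) by (simp add: add_nonneg_pos)
    have "(?x - ?y) / ?y = \<mu> i * (t - a) / (\<mu> i * a + \<sigma>\<^sup>2)"
    proof -
      have "?y = (\<mu> i * a + \<sigma>\<^sup>2) / \<sigma>\<^sup>2" "?x - ?y = \<mu> i * (t - a) / \<sigma>\<^sup>2"
        using assms(2) by (simp_all add: add_divide_distrib diff_divide_distrib right_diff_distrib)
      then show ?thesis using assms(2) by simp
    qed
    then have "ln ?x / ln 2 < (ln ?y + \<mu> i * (t - a) / (\<mu> i * a + \<sigma>\<^sup>2)) / ln 2"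
      using ln_le_tangent_strict[OF pos] by (intro divide_strict_right_mono) simp_all
    then have "log 2 ?x < log 2 ?y + d * (t - a)"
      by (simp add: log_def d_def add_divide_distrib)
    then show ?thesis using d_le by linarith
  qed
qed

text \<open>The Lagrangian separates over the coordinates, and its partial derivative is
  \<open>d + \<beta>\<close> with the slope \<open>d\<close> of
  \<open>alloc_stationary\<close>.\<close>

lemma lagrange_multiplier_alloc:
  fixes \<mu> :: "'n::finite \<Rightarrow> real"
  assumes nonneg: "\<And>i. 0 \<le> \<mu> i" and "\<sigma> > 0" "E > 0" "(\<Sum>i\<in>UNIV. alloc \<sigma> \<mu> \<beta> i) = E"
  shows "lagrange_multiplier E \<sigma> \<mu> (alloc \<sigma> \<mu> \<beta>) \<beta>"
  unfolding lagrange_multiplier_def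
proof (intro conjI allI)
  have \<beta>: "\<beta> < 0" by (rule multiplier_neg) fact+
  then show "\<beta> \<le> 0" by simp
  show "\<beta> * ((\<Sum>i\<in>UNIV. alloc \<sigma> \<mu> \<beta> i) - E) = 0" using assms by simp
  fix i
  let ?a = "alloc \<sigma> \<mu> \<beta>"
  define d where "d = \<mu> i / ((\<mu> i * ?a i + \<sigma>\<^sup>2) * ln 2)"
  let ?c = "(\<Sum>j\<in>UNIV - {i}. log 2 (\<mu> j * ?a j / \<sigma>\<^sup>2 + 1))"
  let ?e = "(\<Sum>j\<in>UNIV - {i}. ?a j)"
  have lag: "lagrangian E \<sigma> \<mu> (?a(i := t)) \<beta> =
      log 2 (\<mu> i * t / \<sigma>\<^sup>2 + 1) + ?c + \<beta> * (t + ?e - E)" for t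
    unfolding lagrangian_def by (simp add: sum.remove[of UNIV i])
  have den: "\<mu> i * ?a i + \<sigma>\<^sup>2 > 0" "\<mu> i * ?a i / \<sigma>\<^sup>2 + 1 > 0"
    using nonneg[of i] assms(2) by (auto simp: alloc_nonneg add_nonneg_pos)
  have "((\<lambda>t. ln (q * t + 1) / ln 2 + ?c + \<beta> * (t + ?e - E)) has_real_derivative
      1 / (q * ?a i + 1) * q / ln 2 + \<beta>) (at (?a i))" if "q * ?a i + 1 > 0" for q
    using that by (auto intro!: derivative_eq_intros)
  from this[of "\<mu> i / \<sigma>\<^sup>2"]
  have "((\<lambda>t. ln (\<mu> i * t / \<sigma>\<^sup>2 + 1) / ln 2 + ?c + \<beta> * (t + ?e - E)) has_real_derivative
      1 / (\<mu> i * ?a i / \<sigma>\<^sup>2 + 1) * (\<mu> i / \<sigma>\<^sup>2) / ln 2 + \<beta>) (at (?a i))"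
    using den(2) by (simp only: times_divide_eq_left)
  moreover have "1 / (\<mu> i * ?a i / \<sigma>\<^sup>2 + 1) * (\<mu> i / \<sigma>\<^sup>2) / ln 2 = d"
  proof -
    have "\<mu> i * ?a i / \<sigma>\<^sup>2 + 1 = (\<mu> i * ?a i + \<sigma>\<^sup>2) / \<sigma>\<^sup>2"
      using assms(2) by (simp add: add_divide_distrib)
    then show ?thesis using assms(2) by (simp add: d_def)
  qed
  ultimately have "((\<lambda>t. log 2 (\<mu> i * t / \<sigma>\<^sup>2 + 1) + ?c + \<beta> * (t + ?e - E)) has_real_derivative
      d + \<beta>) (at (?a i))"
    by (simp add: log_def)
  moreover have "d + \<beta> \<le> 0" "0 < ?a i \<longrightarrow> d + \<beta> = 0"
    using alloc_stationary[where \<mu> = \<mu> and i = i, OF nonneg assms(2) \<beta>] by (auto simp: d_def)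
  ultimately show "\<exists>d. ((\<lambda>t. lagrangian E \<sigma> \<mu> (?a(i := t)) \<beta>) has_real_derivative d) (at (?a i)) \<and>
      d \<le> 0 \<and> (0 < ?a i \<longrightarrow> d = 0)"
    unfolding lag by blast
qed

text \<open>Summing the tangent bounds leaves the linear term
  \<open>- \<beta> * ((\<Sum>i\<in>UNIV. t i) - E)\<close>, which is at most 0 by
  \<open>\<beta> < 0\<close> and the power constraint; index \<open>k\<close> makes the sum of
  bounds strict.\<close>

lemma F_c_less_alloc:
  fixes \<mu> :: "'n::finite \<Rightarrow> real"
  assumes nonneg: "\<And>i. 0 \<le> \<mu> i" and "\<sigma> > 0" "E > 0"
    and sum_E: "(\<Sum>i\<in>UNIV. alloc \<sigma> \<mu> \<beta> i) = E" and "N > 0"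
    and feas: "alloc_feasible E S" and neq: "Re (S $ k $ k) \<noteq> alloc \<sigma> \<mu> \<beta> k"
  shows "F_c N \<sigma> \<mu> S < F_c N \<sigma> \<mu> (diag_matrix (alloc \<sigma> \<mu> \<beta>))"
proof -
  have \<beta>: "\<beta> < 0" by (rule multiplier_neg) fact+
  define t where "t i = Re (S $ i $ i)" for i
  let ?a = "alloc \<sigma> \<mu> \<beta>"
  have t: "0 \<le> t i" "(\<Sum>i\<in>UNIV. t i) \<le> E" for i
    using feas by (auto simp: alloc_feasible_def t_def trace_def)
  have lt: "log 2 (\<mu> i * t i / \<sigma>\<^sup>2 + 1) < log 2 (\<mu> i * ?a i / \<sigma>\<^sup>2 + 1) - \<beta> * (t i - ?a i)"
    if "t i \<noteq> ?a i" for i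
    by (rule log_le_alloc_tangent_strict) (use nonneg assms(2) \<beta> t that in auto)
  have "(\<Sum>i\<in>UNIV. log 2 (\<mu> i * t i / \<sigma>\<^sup>2 + 1)) <
      (\<Sum>i\<in>UNIV. log 2 (\<mu> i * ?a i / \<sigma>\<^sup>2 + 1) - \<beta> * (t i - ?a i))"
  proof (rule sum_strict_mono_ex1)
    have "log 2 (\<mu> i * t i / \<sigma>\<^sup>2 + 1) \<le> log 2 (\<mu> i * ?a i / \<sigma>\<^sup>2 + 1) - \<beta> * (t i - ?a i)" for i
      using lt[of i] by (cases "t i = ?a i") auto
    then show "\<forall>i\<in>UNIV. log 2 (\<mu> i * t i / \<sigma>\<^sup>2 + 1) \<le>
        log 2 (\<mu> i * ?a i / \<sigma>\<^sup>2 + 1) - \<beta> * (t i - ?a i)" by blast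
    show "\<exists>i\<in>UNIV. log 2 (\<mu> i * t i / \<sigma>\<^sup>2 + 1) <
        log 2 (\<mu> i * ?a i / \<sigma>\<^sup>2 + 1) - \<beta> * (t i - ?a i)"
      using lt[of k] neq by (auto simp: t_def)
  qed simp
  also have "\<dots> = (\<Sum>i\<in>UNIV. log 2 (\<mu> i * ?a i / \<sigma>\<^sup>2 + 1)) - \<beta> * ((\<Sum>i\<in>UNIV. t i) - E)"
    by (simp add: sum_subtractf sum_E flip: sum_distrib_left)
  also have "\<dots> \<le> (\<Sum>i\<in>UNIV. log 2 (\<mu> i * ?a i / \<sigma>\<^sup>2 + 1))"
    using \<beta> t(2) by (simp add: mult_nonpos_nonpos)
  finally show ?thesis
    using \<open>N > 0\<close> by (simp add: F_c_def diag_matrix_nth t_def)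
qed

lemma F_c_cong_diag:
  assumes "\<And>i. S $ i $ i = T $ i $ i"
  shows "F_c N \<sigma> \<mu> S = F_c N \<sigma> \<mu> T"
  using assms by (simp add: F_c_def)

lemma alloc_feasible_diag_alloc:
  assumes "(\<Sum>i\<in>UNIV. alloc \<sigma> \<mu> \<beta> i) = E" "\<And>i. S $ i $ i = complex_of_real (alloc \<sigma> \<mu> \<beta> i)"
  shows "alloc_feasible E S"
  using assms by (simp add: alloc_feasible_def trace_def alloc_nonneg)

text \<open>Objective and constraints see only the diagonal of \<open>S\<close>, so uniqueness can
  hold for the diagonal alone. Feasibility makes it real, which lifts equality of real parts to
  equality of entries.\<close>

lemma is_arg_max_F_c_iff:
  fixes \<mu> :: "'n::finite \<Rightarrow> real"
  assumes nonneg: "\<And>i. 0 \<le> \<mu> i" and "\<sigma> > 0" "E > 0"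
    and sum_E: "(\<Sum>i\<in>UNIV. alloc \<sigma> \<mu> \<beta> i) = E" and "N > 0"
  shows "is_arg_max (F_c N \<sigma> \<mu>) (alloc_feasible E) S \<longleftrightarrow>
    (\<forall>i. S $ i $ i = complex_of_real (alloc \<sigma> \<mu> \<beta> i))" (is "?L \<longleftrightarrow> ?R")
proof
  let ?A = "diag_matrix (alloc \<sigma> \<mu> \<beta>)"
  note less = F_c_less_alloc[OF nonneg assms(2-5)]
  {
    assume L: ?L
    have "alloc_feasible E ?A"
      by (rule alloc_feasible_diag_alloc[OF sum_E]) (simp add: diag_matrix_nth)
    then have "Re (S $ i $ i) = alloc \<sigma> \<mu> \<beta> i" for i
      using L less[of S i] unfolding is_arg_max_def by blast
    moreover have "S $ i $ i = complex_of_real (Re (S $ i $ i))" for i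
      using L by (auto simp: is_arg_max_def alloc_feasible_def)
    ultimately show ?R by metis
  next
    assume R: ?R
    have "F_c N \<sigma> \<mu> T \<le> F_c N \<sigma> \<mu> S" if "alloc_feasible E T" for T
    proof -
      have "F_c N \<sigma> \<mu> S = F_c N \<sigma> \<mu> ?A"
        by (rule F_c_cong_diag) (simp add: R diag_matrix_nth)
      moreover have "F_c N \<sigma> \<mu> T \<le> F_c N \<sigma> \<mu> ?A"
      proof (cases "\<exists>k. Re (T $ k $ k) \<noteq> alloc \<sigma> \<mu> \<beta> k")
        case True
        then show ?thesis using less[OF that] by (auto intro: less_imp_le)
      next
        case False
        then show ?thesis by (simp add: F_c_def diag_matrix_nth)
      qed
      ultimately show ?thesis by simp
    qed
    then show ?L
      using alloc_feasible_diag_alloc[OF sum_E] R by (auto simp: is_arg_max_def not_less)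
  }
qed

section \<open>Reduction of the mutual information\<close>

lemma comm_MI_eq_log_det:
  fixes H :: "'c::finite \<Rightarrow> complex^'r::finite^'t::finite"
    and P :: "('c, 't, 'x::finite) blocks measure"
  assumes "\<sigma> > 0" "unitary_matrix U"
    and "block_diag H ** (block_diag H)\<^sup>H = U ** diag_matrix \<mu> ** U\<^sup>H"
  defines "D \<equiv> diag_matrix (\<lambda>i. sqrt (\<mu> i / \<sigma>\<^sup>2))"
  shows "comm_MI \<sigma> H P = real CARD('x) * log 2 (Re (det (mat 1 + D ** S_matrix U P ** D)))"
proof -
  have "det ((block_diag H)\<^sup>H ** Sigma_X P ** block_diag H + mat (complex_of_real (\<sigma>\<^sup>2))) =
      complex_of_real ((\<sigma>\<^sup>2) ^ (CARD('r) * CARD('c))) * det (mat 1 + D ** S_matrix U P ** D)"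
    using det_scaled_congruence[of "\<sigma>\<^sup>2", OF _ assms(2,3), of "Sigma_X P"] assms(1)
    by (simp add: D_def S_matrix_def mult.commute)
  then show ?thesis
    unfolding comm_MI_def using assms(1)
    by (simp add: power_int_minus del: of_nat_mult of_real_power flip: mult.assoc)
qed

lemma sum_log_eq_log_prod:
  assumes "\<And>i. 0 < f i"
  shows "(\<Sum>i\<in>UNIV. log b (f (i :: 'n::finite))) = log b (\<Prod>i\<in>UNIV. f i)"
proof -
  have "ln (\<Prod>i\<in>UNIV. f i) = (\<Sum>i\<in>UNIV. ln (f i))"
    by (intro ln_prod) (simp_all add: assms less_imp_neq[OF assms, symmetric])
  then show ?thesis by (simp add: log_def sum_divide_distrib)
qed

lemma comm_MI_le_F_c:
  fixes H :: "'c::finite \<Rightarrow> complex^'r::finite^'t::finite"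
    and P :: "('c, 't, 'x::finite) blocks measure"
  assumes "\<sigma> > 0" "unitary_matrix U"
    and spectral: "block_diag H ** (block_diag H)\<^sup>H = U ** diag_matrix \<mu> ** U\<^sup>H"
    and "tx_signal P"
  shows "comm_MI \<sigma> H P \<le> F_c CARD('x) \<sigma> \<mu> (S_matrix U P)"
    and "(\<And>i j. i \<noteq> j \<Longrightarrow> S_matrix U P $ i $ j = 0) \<Longrightarrow>
      comm_MI \<sigma> H P = F_c CARD('x) \<sigma> \<mu> (S_matrix U P)"
proof -
  define D where "D = diag_matrix (\<lambda>i. sqrt (\<mu> i / \<sigma>\<^sup>2))"
  define M where "M = mat 1 + D ** S_matrix U P ** D"
  have nonneg: "0 \<le> \<mu> i" for i by (rule eigenvalues_gram_nonneg[OF assms(2) spectral])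
  have "pos_semidef (S_matrix U P)"
    unfolding S_matrix_def by (intro pos_semidef_congruence pos_semidef_Sigma_X assms)
  then have psd: "pos_semidef (D ** S_matrix U P ** D)"
    using pos_semidef_congruence[of "S_matrix U P" D] by (simp add: D_def)
  then have pd: "pos_def M" unfolding M_def by (rule pos_def_one_plus)
  have M_nth: "M $ i $ j = (if i = j then 1 else 0) +
      complex_of_real (sqrt (\<mu> i / \<sigma>\<^sup>2) * sqrt (\<mu> j / \<sigma>\<^sup>2)) * S_matrix U P $ i $ j" for i j
    by (simp add: M_def D_def matrix_mult_diag_nth diag_matrix_mult_nth mat_def)
  have M_diag: "Re (M $ i $ i) = \<mu> i * Re (S_matrix U P $ i $ i) / \<sigma>\<^sup>2 + 1" for i
    using nonneg[of i] by (simp only: M_nth real_sqrt_mult_self) simp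
  have MI: "comm_MI \<sigma> H P = real CARD('x) * log 2 (Re (det M))"
    unfolding M_def D_def by (rule comm_MI_eq_log_det[OF assms(1-3)])
  have F: "F_c CARD('x) \<sigma> \<mu> (S_matrix U P) = real CARD('x) * log 2 (\<Prod>i\<in>UNIV. Re (M $ i $ i))"
    unfolding F_c_def M_diag[symmetric] using pos_def_diag[OF pd] by (simp add: sum_log_eq_log_prod)
  obtain r where r: "r > 0" "det M = complex_of_real r" "r \<le> (\<Prod>i\<in>UNIV. Re (M $ i $ i))"
    using Hadamard_inequality[OF pd] .
  then show "comm_MI \<sigma> H P \<le> F_c CARD('x) \<sigma> \<mu> (S_matrix U P)"
    unfolding MI F by (intro mult_left_mono) auto
  assume "\<And>i j. i \<noteq> j \<Longrightarrow> S_matrix U P $ i $ j = 0"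
  then have "det M = complex_of_real (\<Prod>i\<in>UNIV. Re (M $ i $ i))"
    using pd by (intro det_diag_entries hermitian_diag_real) (auto simp: M_nth pos_def_def)
  then show "comm_MI \<sigma> H P = F_c CARD('x) \<sigma> \<mu> (S_matrix U P)"
    unfolding MI F by (simp del: of_real_prod)
qed

section \<open>Passing between signals and allocations\<close>

lemma tx_feasible_imp_alloc_feasible:
  assumes "unitary_matrix U" "tx_feasible E P"
  shows "alloc_feasible E (S_matrix U P)"
proof -
  have P: "tx_signal P" "avg_power P \<le> E" using assms(2) by (auto simp: tx_feasible_def)
  have "pos_semidef (S_matrix U P)"
    unfolding S_matrix_def by (intro pos_semidef_congruence pos_semidef_Sigma_X P)
  moreover have "Re (trace (S_matrix U P)) \<le> E"
    using P by (simp add: trace_S_matrix assms(1) avg_power_eq_trace)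
  ultimately show ?thesis
    unfolding alloc_feasible_def
    by (metis Reals_of_real hermitian_diag_real pos_semidef_def pos_semidef_diag)
qed

text \<open>\<open>W\<close> is a square root factor of the desired covariance. The diagonal must
  have the form \<open>g (\<mu> i)\<close>: when \<open>U\<close> mixes subcarriers that share an
  eigenvalue, an arbitrary diagonal could give a covariance that is not block diagonal.\<close>

lemma ex_tx_signal_S_matrix_diag:
  fixes K :: "complex^('c::finite \<times> 't::finite)^('c \<times> 't)"
  assumes "unitary_matrix U" "K = U ** diag_matrix \<mu> ** U\<^sup>H"
    and "\<And>i j. fst i \<noteq> fst j \<Longrightarrow> K $ i $ j = 0" and "\<And>x. 0 \<le> g x"
  shows "\<exists>P :: ('c, 't, 'x::finite) blocks measure.
    tx_signal P \<and> S_matrix U P = diag_matrix (\<lambda>i. g (\<mu> i))"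
proof -
  define W where "W = diag_matrix (\<lambda>i. sqrt (g (\<mu> i))) ** U\<^sup>H"
  have "W\<^sup>H ** W =
      U ** (diag_matrix (\<lambda>i. sqrt (g (\<mu> i))) ** diag_matrix (\<lambda>i. sqrt (g (\<mu> i)))) ** U\<^sup>H"
    by (simp add: W_def ctranspose_mult matrix_mul_assoc)
  also have "\<dots> = U ** diag_matrix (\<lambda>i. g (\<mu> i)) ** U\<^sup>H"
    using assms(4) by (simp add: diag_matrix_mult_diag_matrix)
  finally have W: "W\<^sup>H ** W = U ** diag_matrix (\<lambda>i. g (\<mu> i)) ** U\<^sup>H" .
  have "(W\<^sup>H ** W) $ i $ j = 0" if "fst i \<noteq> fst j" for i j
    unfolding W by (rule functional_calculus_block_diagonal[OF assms(1-3) that])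
  then obtain P :: "('c, 't, 'x) blocks measure" where "tx_signal P" "Sigma_X P = W\<^sup>H ** W"
    using tx_signal_with_covariance by blast
  then show ?thesis
    by (intro exI[of _ P])
       (simp add: S_matrix_def W unitary_matrix_cancel[OF assms(1)] flip: matrix_mul_assoc)
qed

text \<open>The objectives may differ at a signal with nondiagonal \<open>S\<close>, so the problems
  are compared through their maximisers. The multiplier is confined to nonzero \<open>\<mu>\<close>:
  otherwise \<open>alloc\<close> vanishes for every \<open>\<beta>\<close> and cannot sum to
  \<open>E > 0\<close>.\<close>

theorem corollary4:
  fixes H :: "'c::finite \<Rightarrow> complex^'r::finite^'t::finite"
    and U :: "complex^('c \<times> 't)^('c \<times> 't)"
    and \<mu> :: "'c \<times> 't \<Rightarrow> real"
    and \<sigma> E :: real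
  assumes "\<sigma> > 0" and "E > 0"
    and "unitary_matrix U"
    and "block_diag H ** (block_diag H)\<^sup>H = U ** diag_matrix \<mu> ** U\<^sup>H"
  shows
    "(\<forall>P :: ('c, 't, 'x::finite) blocks measure. tx_feasible E P \<longrightarrow>
        alloc_feasible E (S_matrix U P) \<and>
        comm_MI \<sigma> H P \<le> F_c CARD('x) \<sigma> \<mu> (S_matrix U P) \<and>
        ((\<forall>i j. i \<noteq> j \<longrightarrow> S_matrix U P $ i $ j = 0) \<longrightarrow>
          comm_MI \<sigma> H P = F_c CARD('x) \<sigma> \<mu> (S_matrix U P)))
     \<and> (\<exists>P :: ('c, 't, 'x) blocks measure.
          is_arg_max (comm_MI \<sigma> H) (tx_feasible E) P \<and>
          is_arg_max (F_c CARD('x) \<sigma> \<mu>) (alloc_feasible E) (S_matrix U P) \<and>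
          comm_MI \<sigma> H P = F_c CARD('x) \<sigma> \<mu> (S_matrix U P))
     \<and> (\<forall>P :: ('c, 't, 'x) blocks measure. is_arg_max (comm_MI \<sigma> H) (tx_feasible E) P \<longrightarrow>
          is_arg_max (F_c CARD('x) \<sigma> \<mu>) (alloc_feasible E) (S_matrix U P))
     \<and> ((\<exists>i. \<mu> i \<noteq> 0) \<longrightarrow>
          (\<exists>!\<beta>. (\<Sum>i\<in>UNIV. alloc \<sigma> \<mu> \<beta> i) - E = 0) \<and>
          (\<forall>\<beta>. (\<Sum>i\<in>UNIV. alloc \<sigma> \<mu> \<beta> i) - E = 0 \<longrightarrow>
            lagrange_multiplier E \<sigma> \<mu> (alloc \<sigma> \<mu> \<beta>) \<beta> \<and>
            (\<forall>S. is_arg_max (F_c CARD('x) \<sigma> \<mu>) (alloc_feasible E) S \<longleftrightarrow>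
              (\<forall>i. S $ i $ i = complex_of_real (alloc \<sigma> \<mu> \<beta> i))) \<and>
            (\<exists>P :: ('c, 't, 'x) blocks measure.
              is_arg_max (comm_MI \<sigma> H) (tx_feasible E) P \<and>
              S_matrix U P = diag_matrix (alloc \<sigma> \<mu> \<beta>))))"
proof -
  let ?MI = "comm_MI \<sigma> H :: ('c, 't, 'x) blocks measure \<Rightarrow> real"
  let ?F = "F_c CARD('x) \<sigma> \<mu>"
  let ?feas = "tx_feasible E :: ('c, 't, 'x) blocks measure \<Rightarrow> bool"
  let ?S = "S_matrix U :: ('c, 't, 'x) blocks measure \<Rightarrow> _"
  note spectral = assms(4)
  have nonneg: "0 \<le> \<mu> i" for i by (rule eigenvalues_gram_nonneg[OF assms(3) spectral])
  have feas: "alloc_feasible E (?S P)" if "?feas P" for P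
    by (rule tx_feasible_imp_alloc_feasible[OF assms(3) that])
  have le: "?MI P \<le> ?F (?S P)" if "?feas P" for P
    using that by (intro comm_MI_le_F_c(1)[OF assms(1,3) spectral]) (simp add: tx_feasible_def)
  have eq: "?MI P = ?F (?S P)" if "?feas P" "\<forall>i j. i \<noteq> j \<longrightarrow> ?S P $ i $ j = 0" for P
    using that by (intro comm_MI_le_F_c(2)[OF assms(1,3) spectral]) (auto simp: tx_feasible_def)
  \<comment> \<open>For every feasible \<open>Q\<close>,
    \<open>?MI Q \<le> ?F (?S Q) \<le> ?F (?S P) = ?MI P\<close>, the last step because
    \<open>?S P\<close> is diagonal.\<close>
  have transfer: "is_arg_max ?MI ?feas P \<and> ?MI P = ?F (?S P)"
    if "?feas P" "is_arg_max ?F (alloc_feasible E) (?S P)" "?S P = diag_matrix d" for P d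
  proof -
    have "?MI P = ?F (?S P)" using that by (intro eq) (auto simp: diag_matrix_nth)
    moreover have "?MI Q \<le> ?F (?S P)" if "?feas Q" for Q
      using le[OF that] feas[OF that] \<open>is_arg_max ?F (alloc_feasible E) (?S P)\<close>
      by (force simp: is_arg_max_def not_less)
    ultimately show ?thesis using that(1) by (auto simp: is_arg_max_def not_less)
  qed
  have signal: "\<exists>P :: ('c, 't, 'x) blocks measure. ?feas P \<and> ?S P = diag_matrix (\<lambda>i. g (\<mu> i))"
    if "\<And>x. 0 \<le> g x" "(\<Sum>i\<in>UNIV. g (\<mu> i)) \<le> E" for g
  proof -
    have "\<exists>P :: ('c, 't, 'x) blocks measure. tx_signal P \<and> ?S P = diag_matrix (\<lambda>i. g (\<mu> i))"
      by (rule ex_tx_signal_S_matrix_diag[OF assms(3) spectral])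
         (rule block_diag_mult_ctranspose_nth that(1) | assumption)+
    then obtain P :: "('c, 't, 'x) blocks measure"
      where P: "tx_signal P" "?S P = diag_matrix (\<lambda>i. g (\<mu> i))"
      by blast
    have "Re (trace (diag_matrix (\<lambda>i. g (\<mu> i)))) = (\<Sum>i\<in>UNIV. g (\<mu> i))"
      by (simp add: trace_def diag_matrix_nth)
    then have "avg_power P \<le> E"
      using that(2) by (simp add: avg_power_eq_trace[OF P(1)] P(2) flip: trace_S_matrix[OF assms(3)])
    then show ?thesis using P by (auto simp: tx_feasible_def)
  qed
  have optimal: "\<exists>P. is_arg_max ?MI ?feas P \<and> is_arg_max ?F (alloc_feasible E) (?S P) \<and>
      ?MI P = ?F (?S P) \<and> ?S P = diag_matrix (alloc \<sigma> \<mu> \<beta>)"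
    if sum_E: "(\<Sum>i\<in>UNIV. alloc \<sigma> \<mu> \<beta> i) = E" for \<beta>
  proof -
    \<comment> \<open>The allocation depends on \<open>i\<close> only through
      \<open>\<mu> i\<close>, as realisation by a signal requires.\<close>
    define g where "g x = (if x \<noteq> 0 then max (- 1 / (\<beta> * ln 2) - \<sigma>\<^sup>2 / x) 0 else 0)" for x
    have g: "alloc \<sigma> \<mu> \<beta> = (\<lambda>i. g (\<mu> i))"
      by (simp add: fun_eq_iff alloc_def g_def)
    have "0 \<le> g x" for x by (simp add: g_def)
    moreover have "(\<Sum>i\<in>UNIV. g (\<mu> i)) \<le> E" using sum_E by (simp add: g)
    ultimately obtain P where P: "?feas P" "?S P = diag_matrix (alloc \<sigma> \<mu> \<beta>)"
      using signal[of g] unfolding g by blast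
    have "is_arg_max ?F (alloc_feasible E) (?S P)"
      unfolding is_arg_max_F_c_iff[where \<mu> = \<mu>, OF nonneg assms(1,2) sum_E zero_less_card_finite] P(2)
      by (simp add: diag_matrix_nth)
    then show ?thesis using transfer[OF P(1) _ P(2)] P(2) by blast
  qed
  have exists: "\<exists>P. is_arg_max ?MI ?feas P \<and> is_arg_max ?F (alloc_feasible E) (?S P) \<and>
      ?MI P = ?F (?S P)"
  proof (cases "\<exists>i. \<mu> i \<noteq> 0")
    case True
    then obtain \<beta> where "(\<Sum>i\<in>UNIV. alloc \<sigma> \<mu> \<beta> i) = E"
      using ex1_multiplier[where \<mu> = \<mu>, OF nonneg assms(2)] by blast
    from optimal[OF this] show ?thesis by blast
  next
    case False
    \<comment> \<open>A zero channel makes \<open>?F\<close> constantly 0, so zero covariance serves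
      as the optimal diagonal matrix.\<close>
    obtain P where P: "?feas P" "?S P = diag_matrix (\<lambda>i. 0)"
      using signal[of "\<lambda>_. 0"] assms(2) by auto
    have "\<mu> i = 0" for i using False by blast
    then have "?F T = 0" for T by (simp add: F_c_def)
    then have "is_arg_max ?F (alloc_feasible E) (?S P)"
      using feas[OF P(1)] by (simp add: is_arg_max_def)
    then show ?thesis using transfer[OF P(1) _ P(2)] by blast
  qed
  \<comment> \<open>A squeeze: \<open>?F (?S Q) = ?MI Q \<le> ?MI P \<le> ?F (?S P)\<close>, where
    \<open>?F (?S Q)\<close> is already maximal.\<close>
  have arg_max: "is_arg_max ?F (alloc_feasible E) (?S P)" if "is_arg_max ?MI ?feas P" for P
  proof -
    obtain Q where Q: "?feas Q" "is_arg_max ?F (alloc_feasible E) (?S Q)" "?MI Q = ?F (?S Q)"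
      using exists by (auto simp: is_arg_max_def)
    have P: "?feas P" "?MI Q \<le> ?MI P" using that Q(1) by (auto simp: is_arg_max_def not_less)
    then have "?F (?S Q) \<le> ?F (?S P)" using Q(3) le[of P] by simp
    then show ?thesis using Q(2) feas[OF P(1)] by (force simp: is_arg_max_def not_less)
  qed
  show ?thesis
  proof (intro conjI allI impI)
    assume "\<exists>i. \<mu> i \<noteq> 0"
    then show "\<exists>!\<beta>. (\<Sum>i\<in>UNIV. alloc \<sigma> \<mu> \<beta> i) - E = 0"
      unfolding right_minus_eq using ex1_multiplier[where \<mu> = \<mu>, OF nonneg assms(2)] by blast
    fix \<beta> assume "(\<Sum>i\<in>UNIV. alloc \<sigma> \<mu> \<beta> i) - E = 0"
    then have sum_E: "(\<Sum>i\<in>UNIV. alloc \<sigma> \<mu> \<beta> i) = E" by simp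
    show "lagrange_multiplier E \<sigma> \<mu> (alloc \<sigma> \<mu> \<beta>) \<beta>"
      by (rule lagrange_multiplier_alloc[where \<mu> = \<mu>, OF nonneg assms(1,2) sum_E])
    show "is_arg_max ?F (alloc_feasible E) S \<longleftrightarrow>
        (\<forall>i. S $ i $ i = complex_of_real (alloc \<sigma> \<mu> \<beta> i))" for S
      by (rule is_arg_max_F_c_iff[where \<mu> = \<mu>, OF nonneg assms(1,2) sum_E zero_less_card_finite])
    show "\<exists>P. is_arg_max ?MI ?feas P \<and> ?S P = diag_matrix (alloc \<sigma> \<mu> \<beta>)"
      using optimal[OF sum_E] by blast
  qed (use feas le eq exists arg_max in blast)+
qed

end
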